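(* Let $D$ be a bounded domain in $\mathbb{C}$, let $S\subset D$ be a closed disc, and let $K\subset\partial D$ be a compact polar set. Then $$\omega(z,S,D)=\inf\{\omega(z,S,D\cup U):U\text{ open},\ K\subset U\},\qquad z\in D.$$ Moreover, if $z\in K$ is a regular boundary point of $D$ (for the Dirichlet problem), then $\inf\{\omega(z,S,D\cup U):U\text{ open},\ K\subset U\}=0$.
   Context: For an open set $\Omega\subset\mathbb{C}$ and $E\subset\Omega$, $\omega(z,E,\Omega)=-\sup\{v(z): v \text{ subharmonic on }\Omega,\ v\le-1\text{ on }E,\ v\le0\text{ on }\Omega\}$, $z\in\Omega$ (for disconnected $\Omega$, computed on each connected component). *)

theory Defs
  imports "HOL-Analysis.Analysis"
begin

definition usc_on :: "complex set \<Rightarrow> (complex \<Rightarrow> ereal) \<Rightarrow> bool" where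
  "usc_on \<Omega> u \<longleftrightarrow> (\<forall>x\<in>\<Omega>. \<forall>c. u x < c \<longrightarrow> (\<forall>\<^sub>F y in at x within \<Omega>. u y < c))"

text \<open>Mean value of u over the circle of centre w and radius r:
  (1/(2 pi)) times the integral over [0, 2 pi] of u(w + r e^{it}),
  computed as (integral of positive part) minus (integral of negative part).\<close>
definition circle_mean :: "(complex \<Rightarrow> ereal) \<Rightarrow> complex \<Rightarrow> real \<Rightarrow> ereal" where
  "circle_mean u w r =
     ereal (1 / (2 * pi)) *
     (enn2ereal (\<integral>\<^sup>+ t\<in>{0..2*pi}. e2ennreal (u (w + of_real r * exp (\<i> * of_real t))) \<partial>lborel)
      - enn2ereal (\<integral>\<^sup>+ t\<in>{0..2*pi}. e2ennreal (- u (w + of_real r * exp (\<i> * of_real t))) \<partial>lborel))"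

text \<open>Subharmonic functions on an open set: values in [-\<infinity>, \<infinity>), upper semicontinuous,
  local sub-mean value inequality. (The function identically -\<infinity> is allowed.)\<close>
definition subharmonic_on :: "complex set \<Rightarrow> (complex \<Rightarrow> ereal) \<Rightarrow> bool" where
  "subharmonic_on \<Omega> u \<longleftrightarrow>
     (\<forall>x\<in>\<Omega>. u x < \<infinity>) \<and> usc_on \<Omega> u \<and>
     (\<forall>w\<in>\<Omega>. \<exists>\<rho>>0. cball w \<rho> \<subseteq> \<Omega> \<and>
        (\<forall>r. 0 < r \<and> r < \<rho> \<longrightarrow> u w \<le> circle_mean u w r))"

definition rel_extremal :: "complex \<Rightarrow> complex set \<Rightarrow> complex set \<Rightarrow> ereal" where
  "rel_extremal z E \<Omega> =
     - (SUP v \<in> {v. subharmonic_on \<Omega> v \<and> (\<forall>x\<in>E. v x \<le> -1) \<and> (\<forall>x\<in>\<Omega>. v x \<le> 0)}. v z)"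

definition polar :: "complex set \<Rightarrow> bool" where
  "polar E \<longleftrightarrow> (\<exists>u. subharmonic_on UNIV u \<and> (\<exists>x. u x \<noteq> -\<infinity>) \<and> (\<forall>x\<in>E. u x = -\<infinity>))"

text \<open>Regular boundary point (Ransford, Def. 4.1.4): existence of a barrier.\<close>
definition regular_boundary_point :: "complex set \<Rightarrow> complex \<Rightarrow> bool" where
  "regular_boundary_point D \<zeta>0 \<longleftrightarrow> \<zeta>0 \<in> frontier D \<and>
     (\<exists>N b. open N \<and> \<zeta>0 \<in> N \<and> subharmonic_on (D \<inter> N) b \<and>
        (\<forall>z\<in>D \<inter> N. b z < 0) \<and>
        (b \<longlongrightarrow> 0) (at \<zeta>0 within D \<inter> N) \<and>
        (\<forall>\<zeta>\<in>D \<inter> frontier N. Limsup (at \<zeta> within D \<inter> N) b < 0))"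

end

theory Submission
  imports Defs "HOL-Complex_Analysis.Complex_Analysis"
begin

text \<open>
  Let \<open>u \<le> 0\<close> be subharmonic with \<open>u = -\<infinity>\<close> on \<open>K\<close>, and let \<open>v\<close> be a competitor for \<open>D\<close>. On the open set
  \<open>U = {\<epsilon>u < -1}\<close>, which contains \<open>K\<close>, the function \<open>max (v + \<epsilon>u) (-1)\<close> equals \<open>-1\<close>, so it extends by
  \<open>-1\<close> to a competitor for \<open>D \<union> U\<close>. Since \<open>z \<notin> K\<close>, replacing \<open>u\<close> by its Poisson integral on a small
  disc around \<open>z\<close> makes \<open>u z\<close> finite, and \<open>\<epsilon> \<rightarrow> 0\<close> gives the first claim.

  If \<open>z \<in> K\<close> is regular, Bouligand's lemma provides a competitor \<open>v\<close> for \<open>D\<close> with \<open>v \<ge> -\<eta>\<close> near \<open>z\<close>.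
  On a small disc around \<open>z\<close> the extended competitor can then be raised to its maximum with
  \<open>-\<eta> + \<epsilon>h\<close>, where \<open>h\<close> is the Poisson integral of \<open>u\<close>: on the boundary circle \<open>h = u\<close>, so nothing
  changes there. As \<open>h z\<close> is finite, \<open>\<epsilon> \<rightarrow> 0\<close> and then \<open>\<eta> \<rightarrow> 0\<close> gives the second claim.
\<close>

subsection \<open>Circle means\<close>

text \<open>The obstacle is that a potential with poles on \<open>K\<close> may be -\<infinity> at
  \<open>z\<close> too, and in the second claim it is, so letting \<epsilon> tend to 0 in
  \<epsilon>u says nothing there. Polarity supplies only some point with a finite value. But a
  subharmonic function that is -\<infinity> on a disc is -\<infinity> everywhere, so finite values
  occur arbitrarily close to \<open>z\<close>, and Harnack's inequality carries finiteness of the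
  Poisson integral from such a point to \<open>z\<close>. The neighbourhood \<open>U\<close> depends
  on \<epsilon> and shrinks with it, which costs nothing because the infimum runs over all
  \<open>U\<close>. Of the Poisson integral only a few properties matter: boundary values,
  semicontinuity up to the circle, domination of subharmonic functions, the bound at the centre and
  Harnack's inequality. All of them pass to decreasing limits of harmonic functions, so poles on the
  boundary circle are admissible.\<close>

abbreviation circ :: "complex \<Rightarrow> real \<Rightarrow> real \<Rightarrow> complex" where
  "circ w r t \<equiv> w + of_real r * exp (\<i> * of_real t)"

lemma circ_in_sphere: "r \<ge> 0 \<Longrightarrow> circ w r t \<in> sphere w r"
  by (simp add: dist_norm norm_mult)

lemma circ_in_cball: "r \<ge> 0 \<Longrightarrow> circ w r t \<in> cball w r"
  using circ_in_sphere by auto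

lemma continuous_on_circ: "continuous_on A (circ w r)"
  by (intro continuous_intros)

section \<open>Upper semicontinuity, and means over circles as extended reals\<close>

lemma usc_on_subset: "usc_on S f \<Longrightarrow> T \<subseteq> S \<Longrightarrow> usc_on T f"
  unfolding usc_on_def by (meson at_le filter_leD subsetD)

lemma usc_on_openin: "usc_on S f \<longleftrightarrow> (\<forall>c. openin (top_of_set S) {x\<in>S. f x < c})"
proof safe
  fix c assume u: "usc_on S f"
  show "openin (top_of_set S) {x\<in>S. f x < c}"
  proof (subst openin_subopen, safe)
    fix x assume x: "x \<in> S" "f x < c"
    then obtain T where T: "open T" "x \<in> T" "\<forall>y\<in>T. y \<noteq> x \<longrightarrow> y \<in> S \<longrightarrow> f y < c"
      using u unfolding usc_on_def eventually_at_topological by meson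
    then have "openin (top_of_set S) (S \<inter> T)" "x \<in> S \<inter> T" "S \<inter> T \<subseteq> {x\<in>S. f x < c}"
      using x by (auto simp: openin_open_Int)
    then show "\<exists>T. openin (top_of_set S) T \<and> x \<in> T \<and> T \<subseteq> {x\<in>S. f x < c}" by blast
  qed
next
  assume o: "\<forall>c. openin (top_of_set S) {x\<in>S. f x < c}"
  show "usc_on S f"
    unfolding usc_on_def
  proof safe
    fix x c assume x: "x \<in> S" "f x < c"
    obtain T where "open T" "{x\<in>S. f x < c} = S \<inter> T"
      using o unfolding openin_open by metis
    then have "open T" "x \<in> T" "\<forall>y\<in>T. y \<noteq> x \<longrightarrow> y \<in> S \<longrightarrow> f y < c" using x by auto
    then show "\<forall>\<^sub>F y in at x within S. f y < c"
      unfolding eventually_at_topological by meson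
  qed
qed

text \<open>The circle stays in \<open>S\<close>, where sublevel sets are traces of open sets, so
  their preimages in the parameter line are open.\<close>

lemma usc_on_circ_measurable:
  assumes "usc_on S f" "\<And>t. circ w r t \<in> S"
  shows "(\<lambda>t. f (circ w r t)) \<in> borel_measurable borel"
proof (rule borel_measurableI_less)
  fix c
  obtain T where T: "open T" "{x\<in>S. f x < c} = S \<inter> T"
    using assms(1) unfolding usc_on_openin openin_open by metis
  have "{t \<in> space borel. f (circ w r t) < c} = circ w r -` T"
    using T assms(2) by (auto simp: set_eq_iff)
  moreover have "open (circ w r -` T)"
    using T(1) continuous_on_circ[of UNIV w r] by (intro open_vimage) auto
  ultimately show "{t \<in> space borel. f (circ w r t) < c} \<in> sets borel"
    by simp
qed

text \<open>The positive part grows and the negative part shrinks; subtraction of extended reals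
  respects this even if a part is infinite.\<close>

lemma circle_mean_mono:
  assumes "\<And>x. x \<in> sphere w r \<Longrightarrow> f x \<le> g x" "r \<ge> 0"
  shows "circle_mean f w r \<le> circle_mean g w r"
proof -
  have *: "f (circ w r t) \<le> g (circ w r t)" for t
    using assms circ_in_sphere by blast
  show ?thesis
    unfolding circle_mean_def
    by (intro ereal_mult_left_mono ereal_minus_mono)
       (auto simp: less_eq_ennreal.rep_eq[symmetric] * intro!: nn_integral_mono mult_right_mono e2ennreal_mono)
qed

lemma circle_mean_cong:
  assumes "\<And>x. x \<in> sphere w r \<Longrightarrow> f x = g x" "r \<ge> 0"
  shows "circle_mean f w r = circle_mean g w r"
  using assms by (intro antisym circle_mean_mono) auto

text \<open>For \<open>f \<le> M\<close> the mean is \<open>M\<close> minus a single nonnegative integral, so that linearity and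
  monotone convergence need no case distinction on infinite negative parts.\<close>

definition circle_deficit :: "real \<Rightarrow> (complex \<Rightarrow> ereal) \<Rightarrow> complex \<Rightarrow> real \<Rightarrow> ennreal" where
  "circle_deficit M f w r = (\<integral>\<^sup>+ t\<in>{0..2*pi}. e2ennreal (ereal M - f (circ w r t)) \<partial>lborel)"

text \<open>As \<open>e2ennreal\<close> cuts negative values to 0, its values at \<open>x\<close>
  and \<open>- x\<close> are the positive and negative part of \<open>x\<close>. The identity is
  kept additive so that it also holds for \<open>x\<close> equal to -\<infinity>; integrated over
  the circle, it links the deficit to the mean.\<close>

lemma e2ennreal_parts:
  assumes "x \<le> ereal M" "M \<ge> 0"
  shows "e2ennreal (ereal M - x) + e2ennreal x = ennreal M + e2ennreal (- x)"
proof (cases x)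
  case (real a)
  then show ?thesis
    using assms by (cases "a \<ge> 0") (auto simp: ennreal_neg simp flip: ennreal_plus)
qed (use assms in \<open>auto simp: e2ennreal_neg\<close>)

lemma circle_mean_eq_deficit:
  assumes meas: "(\<lambda>t. f (circ w r t)) \<in> borel_measurable borel"
    and le: "\<And>x. x \<in> sphere w r \<Longrightarrow> f x \<le> ereal M" and M: "M \<ge> 0" and r: "r \<ge> 0"
  shows "circle_mean f w r = ereal M - ereal (1 / (2*pi)) * enn2ereal (circle_deficit M f w r)"
proof -
  note [measurable] = meas
  define P where "P = (\<integral>\<^sup>+ t\<in>{0..2*pi}. e2ennreal (f (circ w r t)) \<partial>lborel)"
  define N where "N = (\<integral>\<^sup>+ t\<in>{0..2*pi}. e2ennreal (- f (circ w r t)) \<partial>lborel)"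
  define I where "I = circle_deficit M f w r"
  have fle: "f (circ w r t) \<le> ereal M" for t
    using le circ_in_sphere[OF r] by blast
  have "I + P = (\<integral>\<^sup>+ t\<in>{0..2*pi}. e2ennreal (ereal M - f (circ w r t)) + e2ennreal (f (circ w r t)) \<partial>lborel)"
    unfolding I_def P_def circle_deficit_def by (subst nn_integral_add[symmetric]) (auto simp: distrib_right)
  also have "\<dots> = (\<integral>\<^sup>+ t\<in>{0..2*pi}. ennreal M + e2ennreal (- f (circ w r t)) \<partial>lborel)"
    by (simp add: e2ennreal_parts[OF fle M])
  also have "\<dots> = ennreal (2 * pi * M) + N"
    unfolding N_def distrib_right using M
    by (subst nn_integral_add) (auto simp: nn_integral_cmult ennreal_mult' mult.commute)
  finally have eq: "I + P = ennreal (2 * pi * M) + N" .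
  \<comment> \<open>The positive part is at most \<open>M\<close> on an interval of finite length,
    so \<open>P\<close> can be cancelled.\<close>
  have "P \<le> (\<integral>\<^sup>+ t\<in>{0..2*pi}. ennreal M \<partial>lborel)"
    unfolding P_def by (intro nn_integral_mono mult_right_mono) (use e2ennreal_mono[OF fle] in auto)
  also have "\<dots> < top"
    by (simp add: nn_integral_cmult ennreal_mult_less_top)
  finally have "P < top" .
  then obtain p where p: "P = ennreal p" "p \<ge> 0"
    by (cases P) auto
  have "ereal (1 / (2*pi)) * (enn2ereal P - enn2ereal N) = ereal M - ereal (1 / (2*pi)) * enn2ereal I"
  proof (cases N)
    case (real n)
    then obtain i where i: "I = ennreal i" "i \<ge> 0"
      using eq p M by (cases I) (auto simp: ennreal_add_eq_top dest: sym[of top])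
    then have "i + p = 2 * pi * M + n"
      using eq p real M by (simp flip: ennreal_plus)
    then show ?thesis
      using i p real by (simp add: field_simps)
  next
    case top
    \<comment> \<open>An infinite negative part makes both sides -\<infinity>.\<close>
    then have "I = top" using eq p by (cases I) (auto simp flip: ennreal_plus)
    then show ?thesis using top p by simp
  qed
  then show ?thesis
    unfolding P_def N_def I_def circle_mean_def .
qed

text \<open>With bound 2M for the sum, the deficit integrand splits as (M - f) + (M - g), two
  nonnegative functions.\<close>

lemma circle_mean_add:
  assumes "(\<lambda>t. f (circ w r t)) \<in> borel_measurable borel" "(\<lambda>t. g (circ w r t)) \<in> borel_measurable borel"
    and "\<And>x. x \<in> sphere w r \<Longrightarrow> f x \<le> ereal M" "\<And>x. x \<in> sphere w r \<Longrightarrow> g x \<le> ereal M" and M: "M \<ge> 0" and r: "r \<ge> 0"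
  shows "circle_mean (\<lambda>x. f x + g x) w r = circle_mean f w r + circle_mean g w r"
proof -
  note [measurable] = assms(1,2)
  have f: "f (circ w r t) \<le> ereal M" and g: "g (circ w r t) \<le> ereal M" for t
    using assms circ_in_sphere[OF r] by blast+
  have "e2ennreal (ereal (M + M) - (f (circ w r t) + g (circ w r t))) =
      e2ennreal (ereal M - f (circ w r t)) + e2ennreal (ereal M - g (circ w r t))" for t
    using f[of t] g[of t] by (cases "f (circ w r t)"; cases "g (circ w r t)") (auto simp flip: ennreal_plus)
  then have def: "circle_deficit (M + M) (\<lambda>x. f x + g x) w r = circle_deficit M f w r + circle_deficit M g w r"
    unfolding circle_deficit_def by (subst nn_integral_add[symmetric]) (auto simp: distrib_right)
  have le: "f x + g x \<le> ereal (M + M)" if "x \<in> sphere w r" for x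
    using add_mono[OF assms(3)[OF that] assms(4)[OF that]] by simp
  have c: "circle_mean (\<lambda>x. f x + g x) w r
      = ereal (M+M) - ereal (1 / (2*pi)) * enn2ereal (circle_deficit (M+M) (\<lambda>x. f x + g x) w r)"
    by (rule circle_mean_eq_deficit) (use le M r in auto)
  have cf: "circle_mean f w r = ereal M - ereal (1 / (2*pi)) * enn2ereal (circle_deficit M f w r)"
    by (rule circle_mean_eq_deficit) (use assms in auto)
  have cg: "circle_mean g w r = ereal M - ereal (1 / (2*pi)) * enn2ereal (circle_deficit M g w r)"
    by (rule circle_mean_eq_deficit) (use assms in auto)
  show ?thesis
    unfolding c def cf cg
  proof (cases "circle_deficit M f w r"; cases "circle_deficit M g w r")
    fix a b assume ab: "0 \<le> a" "circle_deficit M f w r = ennreal a" "0 \<le> b" "circle_deficit M g w r = ennreal b"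
    then have "enn2ereal (circle_deficit M f w r + circle_deficit M g w r) = ereal (a + b)"
      by (simp flip: ennreal_plus)
    then show "ereal (M + M) - ereal (1 / (2*pi)) * enn2ereal (circle_deficit M f w r + circle_deficit M g w r)
      = ereal M - ereal (1 / (2*pi)) * enn2ereal (circle_deficit M f w r)
        + (ereal M - ereal (1 / (2*pi)) * enn2ereal (circle_deficit M g w r))"
      using ab by (simp add: add_divide_distrib)
  qed simp_all
qed

lemma circle_mean_cmult:
  assumes "(\<lambda>t. f (circ w r t)) \<in> borel_measurable borel"
    and "\<And>x. x \<in> sphere w r \<Longrightarrow> f x \<le> ereal M" and M: "M \<ge> 0" and r: "r \<ge> 0" and c: "c > 0"
  shows "circle_mean (\<lambda>x. ereal c * f x) w r = ereal c * circle_mean f w r"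
proof -
  note [measurable] = assms(1)
  have f: "f (circ w r t) \<le> ereal M" for t
    using assms circ_in_sphere[OF r] by blast+
  have "e2ennreal (ereal (c * M) - (ereal c * f (circ w r t))) =
      ennreal c * e2ennreal (ereal M - f (circ w r t))" for t
    using f[of t] c by (cases "f (circ w r t)") (auto simp: right_diff_distrib ennreal_mult_top simp flip: ennreal_mult')
  then have def: "circle_deficit (c * M) (\<lambda>x. ereal c * f x) w r = ennreal c * circle_deficit M f w r"
    unfolding circle_deficit_def by (subst nn_integral_cmult[symmetric]) (auto simp: mult.assoc)
  have le: "ereal c * f x \<le> ereal (c * M)" if "x \<in> sphere w r" for x
    using ereal_mult_left_mono[OF assms(2)[OF that], of "ereal c"] c by simp
  have e: "circle_mean (\<lambda>x. ereal c * f x) w r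
      = ereal (c * M) - ereal (1 / (2*pi)) * enn2ereal (circle_deficit (c * M) (\<lambda>x. ereal c * f x) w r)"
    by (rule circle_mean_eq_deficit) (use le M r c in auto)
  have cf: "circle_mean f w r = ereal M - ereal (1 / (2*pi)) * enn2ereal (circle_deficit M f w r)"
    by (rule circle_mean_eq_deficit) (use assms in auto)
  show ?thesis
    unfolding e def cf using c
    by (cases "circle_deficit M f w r")
      (auto simp: field_simps ennreal_mult_top simp flip: ennreal_mult')
qed

text \<open>Monotone convergence for the increasing nonnegative functions \<open>M - G n\<close>; an
  infinite limit is allowed and gives mean -\<infinity>.\<close>

lemma circle_mean_INF_decseq:
  fixes G :: "nat \<Rightarrow> complex \<Rightarrow> ereal"
  assumes "\<And>n. (\<lambda>t. G n (circ w r t)) \<in> borel_measurable borel"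
    and "\<And>x n. x \<in> sphere w r \<Longrightarrow> G n x \<le> ereal M" and M: "M \<ge> 0" and r: "r \<ge> 0"
    and dec: "\<And>x n. x \<in> sphere w r \<Longrightarrow> G (Suc n) x \<le> G n x"
  shows "circle_mean (\<lambda>x. INF n. G n x) w r = (INF n. circle_mean (G n) w r)"
proof -
  note [measurable] = assms(1)
  have G: "G n (circ w r t) \<le> ereal M" "G (Suc n) (circ w r t) \<le> G n (circ w r t)" for n t
    using assms circ_in_sphere[OF r] by blast+
  have "ereal M - (INF n. G n (circ w r t)) = (SUP n. ereal M - G n (circ w r t))" for t
    by (simp add: SUP_ereal_minus_right)
  then have e: "e2ennreal (ereal M - (INF n. G n (circ w r t))) = (SUP n. e2ennreal (ereal M - G n (circ w r t)))" for t
    by (simp add: e2ennreal_mono incseq_SucI G ereal_minus_mono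
      sup_continuousD[OF sup_continuous_e2ennreal[OF sup_continuous_id]])
  have "circle_deficit M (\<lambda>x. INF n. G n x) w r
     = (\<integral>\<^sup>+ t. (SUP n. e2ennreal (ereal M - G n (circ w r t)) * indicator {0..2*pi} t) \<partial>lborel)"
    unfolding circle_deficit_def e by (simp add: SUP_mult_right_ennreal)
  also have "\<dots> = (SUP n. circle_deficit M (G n) w r)"
    unfolding circle_deficit_def
    by (intro nn_integral_monotone_convergence_SUP)
      (auto simp: incseq_Suc_iff le_fun_def intro!: mult_right_mono e2ennreal_mono ereal_minus_mono G)
  finally have def: "circle_deficit M (\<lambda>x. INF n. G n x) w r = (SUP n. circle_deficit M (G n) w r)" .
  have inc: "incseq (\<lambda>n. circle_deficit M (G n) w r)"
    unfolding circle_deficit_def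
    by (auto simp: incseq_Suc_iff le_fun_def intro!: nn_integral_mono mult_right_mono e2ennreal_mono ereal_minus_mono G)
  have le: "(INF n. G n x) \<le> ereal M" if "x \<in> sphere w r" for x
    using assms(2)[OF that] by (intro INF_lower2[of 0]) auto
  have "circle_mean (\<lambda>x. INF n. G n x) w r
      = ereal M - ereal (1 / (2*pi)) * enn2ereal (circle_deficit M (\<lambda>x. INF n. G n x) w r)"
    by (rule circle_mean_eq_deficit) (use le M r in auto)
  also have "\<dots> = ereal M - ereal (1 / (2*pi)) * (SUP n. enn2ereal (circle_deficit M (G n) w r))"
    unfolding def using inc by (simp add: sup_continuousD[OF sup_continuous_enn2ereal[OF sup_continuous_id]])
  also have "\<dots> = ereal M - (SUP n. ereal (1 / (2*pi)) * enn2ereal (circle_deficit M (G n) w r))"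
    by (subst Sup_ereal_mult_left') auto
  also have "\<dots> = (INF n. ereal M - ereal (1 / (2*pi)) * enn2ereal (circle_deficit M (G n) w r))"
    by (subst INF_ereal_minus_right) auto
  also have "\<dots> = (INF n. circle_mean (G n) w r)"
    by (intro INF_cong refl circle_mean_eq_deficit[symmetric]) (use assms in auto)
  finally show ?thesis .
qed

section \<open>The mean value property of real parts of holomorphic functions\<close>

lemma has_integral_circ_holomorphic:
  fixes F :: "complex \<Rightarrow> complex"
  assumes "F holomorphic_on ball w R" "0 < r" "r < R"
  shows "((\<lambda>t. F (circ w r t)) has_integral (2 * pi * F w)) {0..2*pi}"
proof -
  have sub: "cball w r \<subseteq> ball w R" using assms by auto
  \<comment> \<open>Cauchy's formula at the centre: along the circle, du / (u - w) equals \<i>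
    dt.\<close>
  have "((\<lambda>u. F u / (u - w)) has_contour_integral (2 * of_real pi * \<i> * F w)) (circlepath w r)"
    using assms holomorphic_on_subset[OF assms(1) sub]
    by (intro Cauchy_integral_circlepath_simple) auto
  then have "((\<lambda>t. F (w + r * cis t) / (w + r * cis t - w) * r * \<i> * cis t) has_integral (2 * of_real pi * \<i> * F w)) {0..2*pi}"
    unfolding circlepath_def using assms
    by (subst (asm) has_contour_integral_part_circlepath_iff) auto
  then have "((\<lambda>t. F (w + r * cis t) * \<i>) has_integral (2 * of_real pi * \<i> * F w)) {0..2*pi}"
    using assms by (simp add: field_simps)
  from has_integral_mult_left[OF this, of "-\<i>"]
  show ?thesis by (simp add: cis_conv_exp mult.commute mult.left_commute)
qed

lemma circle_mean_Re_holomorphic: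
  fixes F :: "complex \<Rightarrow> complex"
  assumes "F holomorphic_on ball w R" "0 < r" "r < R"
  shows "circle_mean (\<lambda>x. ereal (Re (F x))) w r = ereal (Re (F w))"
proof -
  have sub: "sphere w r \<subseteq> ball w R" using assms by auto
  have cont: "continuous_on (sphere w r) F"
    using assms(1) sub holomorphic_on_imp_continuous_on continuous_on_subset by blast
  have "bounded (F ` sphere w r)"
    by (intro compact_imp_bounded compact_continuous_image cont) auto
  then obtain M where M: "M > 0" "\<And>x. x \<in> sphere w r \<Longrightarrow> norm (F x) \<le> M"
    unfolding bounded_pos by auto
  have le: "Re (F x) \<le> M" if "x \<in> sphere w r" for x
    using M(2)[OF that] complex_Re_le_cmod[of "F x"] by linarith
  have cm: "continuous_on UNIV (\<lambda>t. Re (F (circ w r t)))"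
    by (intro continuous_intros continuous_on_compose2[OF cont]) (use circ_in_sphere assms in auto)
  have meas: "(\<lambda>t. ereal (Re (F (circ w r t)))) \<in> borel_measurable borel"
    using borel_measurable_continuous_onI[OF cm] by simp
  have "((\<lambda>t. Re (F (circ w r t))) has_integral Re (2 * pi * F w)) {0..2*pi}"
    using has_integral_circ_holomorphic[OF assms] by (rule has_integral_Re)
  then have "((\<lambda>t. M - Re (F (circ w r t))) has_integral (2 * pi * M - 2 * pi * Re (F w))) {0..2*pi}"
    using has_integral_diff[OF has_integral_const_real[of M 0 "2*pi"]] by (simp add: mult.commute)
  then have I: "((\<lambda>t. M - Re (F (circ w r t))) has_integral (2 * pi * (M - Re (F w)))) {0..2*pi}"
    by (simp add: algebra_simps)
  have nn: "0 \<le> M - Re (F (circ w r t))" for t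
    using le[OF circ_in_sphere[of r w t]] assms by simp
  \<comment> \<open>Nonnegativity of \<open>M - Re F\<close> is what turns the gauge integral of
    Cauchy's formula into the Lebesgue integral of the deficit.\<close>
  have "integral\<^sup>N lborel (\<lambda>t. indicator {0..2*pi} t * (M - Re (F (circ w r t)))) = ennreal (2 * pi * (M - Re (F w)))"
    by (rule nn_integral_has_integral_lebesgue[OF nn I])
  then have d: "circle_deficit M (\<lambda>x. ereal (Re (F x))) w r = ennreal (2 * pi * (M - Re (F w)))"
    unfolding circle_deficit_def using nn by (simp add: ennreal_mult' ennreal_indicator mult.commute)
  have "0 \<le> 2 * pi * (M - Re (F w))"
    using has_integral_nonneg[OF I] nn by blast
  then show ?thesis
    using M le assms by (subst circle_mean_eq_deficit[OF meas, of M]) (auto simp: d)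
qed

lemma circle_mean_const: "0 < r \<Longrightarrow> circle_mean (\<lambda>x. ereal a) w r = ereal a"
  using circle_mean_Re_holomorphic[of "\<lambda>_. of_real a" w "r+1" r] by simp

section \<open>Extrema and algebra of upper semicontinuous functions\<close>

lemma usc_on_attains_sup:
  assumes "compact S" "S \<noteq> {}" "usc_on S f"
  obtains a where "a \<in> S" "\<And>x. x \<in> S \<Longrightarrow> f x \<le> f a"
proof -
  have "\<exists>a\<in>S. \<forall>x\<in>S. f x \<le> f a"
  proof (rule ccontr)
    assume "\<not> ?thesis"
    then have "\<forall>a\<in>S. \<exists>x\<in>S. f a < f x" by (auto simp: not_le)
    then obtain X where X: "\<And>a. a \<in> S \<Longrightarrow> X a \<in> S \<and> f a < f (X a)" by metis
    have "\<exists>T. open T \<and> {x\<in>S. f x < f (X a)} = S \<inter> T" for a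
      using assms(3) unfolding usc_on_openin openin_open by metis
    then obtain T where T: "\<And>a. open (T a)" "\<And>a. {x\<in>S. f x < f (X a)} = S \<inter> T a" by metis
    have "S \<subseteq> (\<Union>a\<in>S. T a)" using X T by blast
    then obtain A where A: "A \<subseteq> S" "finite A" "S \<subseteq> (\<Union>a\<in>A. T a)"
      using compactE_image[OF assms(1), of S T] T by metis
    then have "A \<noteq> {}" using assms by auto
    \<comment> \<open>Without a maximum, the sets where \<open>f\<close> lies below
      \<open>f (X a)\<close> cover \<open>S\<close>. In a finite subcover the highest threshold
      \<open>f (X m)\<close> would itself lie strictly below another threshold.\<close>
    then have "Max ((\<lambda>a. f (X a)) ` A) \<in> (\<lambda>a. f (X a)) ` A"
      using A(2) by (intro Max_in) auto
    then obtain m where "m \<in> A" "f (X m) = Max ((\<lambda>a. f (X a)) ` A)" by auto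
    then have m: "m \<in> A" "\<And>a. a \<in> A \<Longrightarrow> f (X a) \<le> f (X m)"
      using A(2) by auto
    then obtain a where "a \<in> A" "X m \<in> T a" using A X by blast
    then have "f (X m) < f (X a)" using T(2)[of a] X m A by blast
    then show False using m \<open>a \<in> A\<close> by (meson not_le)
  qed
  then show ?thesis using that by blast
qed

lemma usc_on_compact_bounded_above:
  assumes "compact S" "usc_on S f" "\<And>x. x \<in> S \<Longrightarrow> f x < \<infinity>"
  obtains M where "M \<ge> 0" "\<And>x. x \<in> S \<Longrightarrow> f x \<le> ereal M"
proof (cases "S = {}")
  case False
  then obtain a where a: "a \<in> S" "\<And>x. x \<in> S \<Longrightarrow> f x \<le> f a"
    using usc_on_attains_sup assms by metis
  have "f a \<le> ereal (max 0 (real_of_ereal (f a)))"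
    using assms(3)[OF a(1)] by (cases "f a") auto
  then show ?thesis using a that[of "max 0 (real_of_ereal (f a))"] by (meson max.cobounded1 order_trans)
qed (use that[of 0] in auto)

lemma usc_on_add:
  assumes "usc_on S f" "usc_on S g" "\<And>x. x \<in> S \<Longrightarrow> f x < \<infinity>" "\<And>x. x \<in> S \<Longrightarrow> g x < \<infinity>"
  shows "usc_on S (\<lambda>x. f x + g x)"
  unfolding usc_on_def
proof (intro ballI allI impI)
  fix x c assume x: "x \<in> S" and c: "f x + g x < c"
  \<comment> \<open>The bound is split into one for each summand. If one summand is -\<infinity>,
    its threshold can be chosen as low as the other one requires. Thresholds below \<infinity> keep
    the sum of the two inequalities strict.\<close>
  have "\<exists>a b. f x < a \<and> g x < b \<and> a + b \<le> c \<and> a < \<infinity> \<and> b < \<infinity>"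
  proof (cases c)
    case PInf
    then show ?thesis using assms(3,4)[OF x] ereal_dense2 by (metis ereal_less_eq(1) ereal_less_PInfty)
  next
    case MInf then show ?thesis using c by simp
  next
    case (real c')
    show ?thesis
    proof (cases "f x")
      case fr: (real f')
      show ?thesis
      proof (cases "g x")
        case (real g')
        let ?d = "(c' - f' - g') / 2"
        have "f' + g' < c'" using c real fr \<open>c = ereal c'\<close> by simp
        then show ?thesis using real fr \<open>c = ereal c'\<close>
          by (intro exI[of _ "ereal (f' + ?d)"] exI[of _ "ereal (g' + ?d)"]) (auto simp: field_simps)
      next
        case MInf
        then show ?thesis using fr \<open>c = ereal c'\<close>
          by (intro exI[of _ "ereal (f' + 1)"] exI[of _ "ereal (c' - f' - 1)"]) auto
      qed (use assms x in auto)
    next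
      case MInf
      obtain b where "g x < ereal b" using assms(4)[OF x] less_PInf_Ex_of_nat by auto
      then show ?thesis using MInf \<open>c = ereal c'\<close>
        by (intro exI[of _ "ereal (c' - b)"] exI[of _ "ereal b"]) auto
    qed (use assms x in auto)
  qed
  then obtain a b where ab: "f x < a" "g x < b" "a + b \<le> c" "a < \<infinity>" "b < \<infinity>" by blast
  have "\<forall>\<^sub>F y in at x within S. f y < a" "\<forall>\<^sub>F y in at x within S. g y < b"
    using assms(1,2) x ab unfolding usc_on_def by auto
  then show "\<forall>\<^sub>F y in at x within S. f y + g y < c"
  proof eventually_elim
    case (elim y)
    then have "f y + g y < a + b"
      using ab by (cases "f y"; cases "g y"; cases a; cases b) auto
    then show ?case using ab by simp
  qed
qed

lemma usc_on_cmult: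
  assumes "usc_on S f" "c > 0"
  shows "usc_on S (\<lambda>x. ereal c * f x)"
  unfolding usc_on_def
proof (intro ballI allI impI)
  fix x b assume x: "x \<in> S" and b: "ereal c * f x < b"
  have eq: "ereal c * y < b \<longleftrightarrow> y < ereal (1/c) * b" for y
    using assms(2) by (cases y; cases b) (auto simp: field_simps)
  show "\<forall>\<^sub>F y in at x within S. ereal c * f y < b"
    using assms(1) x b unfolding usc_on_def eq by auto
qed

lemma usc_on_continuous:
  assumes "continuous_on S g" shows "usc_on S (\<lambda>x. ereal (g x))"
  unfolding usc_on_def
proof (intro ballI allI impI)
  fix x c assume "x \<in> S" and c: "ereal (g x) < c"
  have "((\<lambda>y. ereal (g y)) \<longlongrightarrow> ereal (g x)) (at x within S)"
    using assms \<open>x \<in> S\<close> by (auto simp: continuous_on_def intro: tendsto_intros)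
  then show "\<forall>\<^sub>F y in at x within S. ereal (g y) < c"
    using c by (rule order_tendstoD(2))
qed

subsection \<open>Subharmonic functions\<close>

text \<open>A property of the germ at \<open>w\<close> alone, with no reference to a domain. Unions,
  local modifications and gluing can thus be checked one point at a time.\<close>

definition subharmonic_at :: "(complex \<Rightarrow> ereal) \<Rightarrow> complex \<Rightarrow> bool" where
  "subharmonic_at u w \<longleftrightarrow> u w < \<infinity> \<and> (\<forall>c. u w < c \<longrightarrow> (\<forall>\<^sub>F y in nhds w. u y < c)) \<and>
     (\<exists>\<rho>>0. \<forall>r. 0 < r \<and> r < \<rho> \<longrightarrow> u w \<le> circle_mean u w r)"

lemma subharmonic_on_iff:
  assumes "open \<Omega>"
  shows "subharmonic_on \<Omega> u \<longleftrightarrow> (\<forall>w\<in>\<Omega>. subharmonic_at u w)"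
proof -
  have 1: "usc_on \<Omega> u \<longleftrightarrow> (\<forall>w\<in>\<Omega>. \<forall>c. u w < c \<longrightarrow> (\<forall>\<^sub>F y in nhds w. u y < c))"
    unfolding usc_on_def using at_within_open[OF _ assms] by (auto simp: eventually_nhds_conv_at)
  have 2: "(\<exists>\<rho>>0. cball w \<rho> \<subseteq> \<Omega> \<and> (\<forall>r. 0 < r \<and> r < \<rho> \<longrightarrow> u w \<le> circle_mean u w r))
      \<longleftrightarrow> (\<exists>\<rho>>0. \<forall>r. 0 < r \<and> r < \<rho> \<longrightarrow> u w \<le> circle_mean u w r)" if w: "w \<in> \<Omega>" for w
  proof
    assume "\<exists>\<rho>>0. \<forall>r. 0 < r \<and> r < \<rho> \<longrightarrow> u w \<le> circle_mean u w r"
    then obtain \<rho> where \<rho>: "\<rho> > 0" "\<forall>r. 0 < r \<and> r < \<rho> \<longrightarrow> u w \<le> circle_mean u w r" by blast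
    obtain e where e: "e > 0" "cball w e \<subseteq> \<Omega>" using assms w open_contains_cball by blast
    have "min \<rho> e > 0" "cball w (min \<rho> e) \<subseteq> \<Omega>" using e \<rho> by auto
    then show "\<exists>\<rho>>0. cball w \<rho> \<subseteq> \<Omega> \<and> (\<forall>r. 0 < r \<and> r < \<rho> \<longrightarrow> u w \<le> circle_mean u w r)"
      using \<rho> by (intro exI[of _ "min \<rho> e"]) auto
  qed blast
  show ?thesis
    unfolding subharmonic_on_def subharmonic_at_def 1 using 2 by blast
qed

lemma subharmonic_on_subset:
  assumes "subharmonic_on S u" "open S" "open T" "T \<subseteq> S"
  shows "subharmonic_on T u"
  using assms by (auto simp: subharmonic_on_iff)

lemma subharmonic_on_Un:
  assumes "subharmonic_on S u" "subharmonic_on T u" "open S" "open T"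
  shows "subharmonic_on (S \<union> T) u"
  using assms by (auto simp: subharmonic_on_iff open_Un)

lemma subharmonic_at_cong:
  assumes "\<forall>\<^sub>F y in nhds w. u y = v y" "subharmonic_at u w"
  shows "subharmonic_at v w"
proof -
  have eq: "u w = v w" using assms(1) eventually_nhds_x_imp_x by fastforce
  obtain e where e: "e > 0" "\<And>y. dist y w < e \<Longrightarrow> u y = v y"
    using assms(1) unfolding eventually_nhds_metric by blast
  obtain \<rho> where \<rho>: "\<rho> > 0" "\<forall>r. 0 < r \<and> r < \<rho> \<longrightarrow> u w \<le> circle_mean u w r"
    using assms(2) unfolding subharmonic_at_def by blast
  have "v w \<le> circle_mean v w r" if "0 < r" "r < min \<rho> e" for r
    using circle_mean_cong[of w r u v] e \<rho> that eq by (auto simp: dist_commute)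
  moreover have "\<forall>\<^sub>F y in nhds w. v y < c" if "v w < c" for c
  proof -
    have "\<forall>\<^sub>F y in nhds w. u y < c" using assms(2) that eq unfolding subharmonic_at_def by auto
    then show ?thesis using assms(1) by eventually_elim auto
  qed
  ultimately show ?thesis
    using assms(2) e \<rho> eq unfolding subharmonic_at_def by (metis min_less_iff_conj)
qed

lemma subharmonic_on_cong:
  assumes "open S" "\<And>x. x \<in> S \<Longrightarrow> u x = v x" "subharmonic_on S u"
  shows "subharmonic_on S v"
  unfolding subharmonic_on_iff[OF assms(1)]
proof
  fix w assume "w \<in> S"
  moreover from this have "\<forall>\<^sub>F y in nhds w. u y = v y"
    using assms(1,2) eventually_nhds by blast
  ultimately show "subharmonic_at v w"
    using assms subharmonic_at_cong subharmonic_on_iff by blast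
qed

lemma subharmonic_at_max:
  assumes "subharmonic_at u w" "subharmonic_at v w"
  shows "subharmonic_at (\<lambda>x. max (u x) (v x)) w"
proof -
  obtain \<rho>1 where \<rho>1: "\<rho>1 > 0" "\<forall>r. 0 < r \<and> r < \<rho>1 \<longrightarrow> u w \<le> circle_mean u w r"
    using assms(1) unfolding subharmonic_at_def by blast
  obtain \<rho>2 where \<rho>2: "\<rho>2 > 0" "\<forall>r. 0 < r \<and> r < \<rho>2 \<longrightarrow> v w \<le> circle_mean v w r"
    using assms(2) unfolding subharmonic_at_def by blast
  have "max (u w) (v w) \<le> circle_mean (\<lambda>x. max (u x) (v x)) w r" if "0 < r" "r < min \<rho>1 \<rho>2" for r
  proof -
    have "u w \<le> circle_mean (\<lambda>x. max (u x) (v x)) w r"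
      using \<rho>1 that circle_mean_mono[of w r u "\<lambda>x. max (u x) (v x)"] by (meson max.cobounded1 less_imp_le min_less_iff_conj order_trans)
    moreover have "v w \<le> circle_mean (\<lambda>x. max (u x) (v x)) w r"
      using \<rho>2 that circle_mean_mono[of w r v "\<lambda>x. max (u x) (v x)"] by (meson max.cobounded2 less_imp_le min_less_iff_conj order_trans)
    ultimately show ?thesis by simp
  qed
  then have "\<exists>\<rho>>0. \<forall>r. 0 < r \<and> r < \<rho> \<longrightarrow> max (u w) (v w) \<le> circle_mean (\<lambda>x. max (u x) (v x)) w r"
    using \<rho>1(1) \<rho>2(1) by (intro exI[of _ "min \<rho>1 \<rho>2"]) auto
  moreover have "\<forall>\<^sub>F y in nhds w. max (u y) (v y) < c" if "max (u w) (v w) < c" for c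
    using assms that unfolding subharmonic_at_def by (auto intro: eventually_conj)
  moreover have "max (u w) (v w) < \<infinity>"
    using assms unfolding subharmonic_at_def max_less_iff_conj by blast
  ultimately show ?thesis
    unfolding subharmonic_at_def by blast
qed

lemma subharmonic_on_max:
  assumes "open S" "subharmonic_on S u" "subharmonic_on S v"
  shows "subharmonic_on S (\<lambda>x. max (u x) (v x))"
  using assms by (auto simp: subharmonic_on_iff intro: subharmonic_at_max)

text \<open>Semicontinuity bounds \<open>u\<close> above on a compact disc; this is the constant
  \<open>M\<close> that the deficit identities for sums and multiples require.\<close>

lemma subharmonic_on_local_bound:
  assumes "subharmonic_on S u" "w \<in> S"
  obtains \<rho> M where "\<rho> > 0" "M \<ge> 0" "cball w \<rho> \<subseteq> S" "\<And>x. x \<in> cball w \<rho> \<Longrightarrow> u x \<le> ereal M"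
    "\<And>r. 0 < r \<Longrightarrow> r < \<rho> \<Longrightarrow> u w \<le> circle_mean u w r"
proof -
  obtain \<rho> where \<rho>: "\<rho> > 0" "cball w \<rho> \<subseteq> S" "\<And>r. 0 < r \<Longrightarrow> r < \<rho> \<Longrightarrow> u w \<le> circle_mean u w r"
    using assms unfolding subharmonic_on_def by metis
  have "usc_on (cball w \<rho>) u" "\<And>x. x \<in> cball w \<rho> \<Longrightarrow> u x < \<infinity>"
    using assms \<rho> usc_on_subset unfolding subharmonic_on_def by blast+
  then obtain M where "M \<ge> 0" "\<And>x. x \<in> cball w \<rho> \<Longrightarrow> u x \<le> ereal M"
    using usc_on_compact_bounded_above[OF compact_cball] by metis
  then show ?thesis using that \<rho> by blast
qed

lemma subharmonic_on_circ_measurable: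
  assumes "subharmonic_on S u" "cball w r \<subseteq> S" "r \<ge> 0"
  shows "(\<lambda>t. u (circ w r t)) \<in> borel_measurable borel"
  using assms circ_in_cball[of r w] by (intro usc_on_circ_measurable[of S]) (auto simp: subharmonic_on_def)

lemma subharmonic_on_add:
  assumes S: "open S" and u: "subharmonic_on S u" and v: "subharmonic_on S v"
  shows "subharmonic_on S (\<lambda>x. u x + v x)"
  unfolding subharmonic_on_def
proof (intro conjI ballI)
  fix x assume "x \<in> S"
  then show "u x + v x < \<infinity>" using u v unfolding subharmonic_on_def by auto
next
  show "usc_on S (\<lambda>x. u x + v x)"
    using u v unfolding subharmonic_on_def by (intro usc_on_add) auto
next
  fix w assume w: "w \<in> S"
  obtain \<rho>1 M1 where 1: "\<rho>1 > 0" "M1 \<ge> 0" "cball w \<rho>1 \<subseteq> S" "\<And>x. x \<in> cball w \<rho>1 \<Longrightarrow> u x \<le> ereal M1"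
    "\<And>r. 0 < r \<Longrightarrow> r < \<rho>1 \<Longrightarrow> u w \<le> circle_mean u w r"
    using subharmonic_on_local_bound[OF u w] by metis
  obtain \<rho>2 M2 where 2: "\<rho>2 > 0" "M2 \<ge> 0" "cball w \<rho>2 \<subseteq> S" "\<And>x. x \<in> cball w \<rho>2 \<Longrightarrow> v x \<le> ereal M2"
    "\<And>r. 0 < r \<Longrightarrow> r < \<rho>2 \<Longrightarrow> v w \<le> circle_mean v w r"
    using subharmonic_on_local_bound[OF v w] by metis
  have "u w + v w \<le> circle_mean (\<lambda>x. u x + v x) w r" if r: "0 < r" "r < min \<rho>1 \<rho>2" for r
  proof -
    have "cball w r \<subseteq> S" using 1 r by auto
    have "circle_mean (\<lambda>x. u x + v x) w r = circle_mean u w r + circle_mean v w r"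
    proof (rule circle_mean_add[of _ _ _ _ "max M1 M2"])
      show "(\<lambda>t. u (circ w r t)) \<in> borel_measurable borel" "(\<lambda>t. v (circ w r t)) \<in> borel_measurable borel"
        using subharmonic_on_circ_measurable u v \<open>cball w r \<subseteq> S\<close> r by auto
      fix x assume "x \<in> sphere w r"
      then have "x \<in> cball w \<rho>1" "x \<in> cball w \<rho>2" using r by auto
      then show "u x \<le> ereal (max M1 M2)" "v x \<le> ereal (max M1 M2)"
        using 1(4)[of x] 2(4)[of x] unfolding ereal_max by (meson max.coboundedI1 max.coboundedI2)+
    qed (use 1 2 r in auto)
    then show ?thesis using 1(5)[of r] 2(5)[of r] r by (auto intro: add_mono)
  qed
  moreover have "cball w (min \<rho>1 \<rho>2) \<subseteq> S" using 1 by auto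
  ultimately show "\<exists>\<rho>>0. cball w \<rho> \<subseteq> S \<and> (\<forall>r. 0 < r \<and> r < \<rho> \<longrightarrow> u w + v w \<le> circle_mean (\<lambda>x. u x + v x) w r)"
    using 1(1) 2(1) by (intro exI[of _ "min \<rho>1 \<rho>2"]) auto
qed

lemma subharmonic_on_cmult:
  assumes u: "subharmonic_on S u" and c: "c > 0"
  shows "subharmonic_on S (\<lambda>x. ereal c * u x)"
  unfolding subharmonic_on_def
proof (intro conjI ballI)
  fix x assume "x \<in> S"
  then show "ereal c * u x < \<infinity>" using u c unfolding subharmonic_on_def by (cases "u x") auto
next
  show "usc_on S (\<lambda>x. ereal c * u x)"
    using u c unfolding subharmonic_on_def by (intro usc_on_cmult) auto
next
  fix w assume w: "w \<in> S"
  obtain \<rho>1 M1 where 1: "\<rho>1 > 0" "M1 \<ge> 0" "cball w \<rho>1 \<subseteq> S" "\<And>x. x \<in> cball w \<rho>1 \<Longrightarrow> u x \<le> ereal M1"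
    "\<And>r. 0 < r \<Longrightarrow> r < \<rho>1 \<Longrightarrow> u w \<le> circle_mean u w r"
    using subharmonic_on_local_bound[OF u w] by metis
  have "ereal c * u w \<le> circle_mean (\<lambda>x. ereal c * u x) w r" if r: "0 < r" "r < \<rho>1" for r
  proof -
    have "cball w r \<subseteq> S" using 1 r by auto
    then have "(\<lambda>t. u (circ w r t)) \<in> borel_measurable borel"
      using subharmonic_on_circ_measurable u r by auto
    then have "circle_mean (\<lambda>x. ereal c * u x) w r = ereal c * circle_mean u w r"
      by (rule circle_mean_cmult[of _ _ _ M1]) (use 1 r c in auto)
    then show ?thesis using 1(5)[of r] r c by (auto intro: ereal_mult_left_mono)
  qed
  then show "\<exists>\<rho>>0. cball w \<rho> \<subseteq> S \<and> (\<forall>r. 0 < r \<and> r < \<rho> \<longrightarrow> ereal c * u w \<le> circle_mean (\<lambda>x. ereal c * u x) w r)"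
    using 1(1,3) by (intro exI[of _ \<rho>1]) auto
qed

lemma subharmonic_on_const: "open S \<Longrightarrow> subharmonic_on S (\<lambda>_. ereal a)"
  by (auto simp: subharmonic_on_iff subharmonic_at_def circle_mean_const intro: exI[of _ 1])

text \<open>Only points of the circle are delicate. There the value is that of \<open>u\<close>, and
  the glued function dominates \<open>u\<close> everywhere, so it inherits the sub-mean inequality.
  Semicontinuity of \<open>s\<close> up to the circle, with \<open>s \<le> u\<close> on it, keeps
  the glued function from jumping up nearby.\<close>

lemma subharmonic_on_glue:
  assumes S: "open S" and u: "subharmonic_on S u"
    and s: "usc_on (S \<inter> cball a \<rho>) s" "subharmonic_on (S \<inter> ball a \<rho>) s"
    and le: "\<And>x. x \<in> S \<inter> sphere a \<rho> \<Longrightarrow> s x \<le> u x"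
  shows "subharmonic_on S (\<lambda>x. if x \<in> cball a \<rho> then max (u x) (s x) else u x)"
    (is "subharmonic_on S ?v")
  unfolding subharmonic_on_iff[OF S]
proof
  fix w assume w: "w \<in> S"
  have uw: "subharmonic_at u w" using u S w by (simp add: subharmonic_on_iff)
  consider "dist a w < \<rho>" | "dist a w > \<rho>" | "dist a w = \<rho>" by linarith
  then show "subharmonic_at ?v w"
  proof cases
    case 1
    then have "subharmonic_at s w"
      using s(2) S w by (auto simp: subharmonic_on_iff open_Int)
    then have "subharmonic_at (\<lambda>x. max (u x) (s x)) w"
      using subharmonic_at_max uw by blast
    moreover have "\<forall>\<^sub>F y in nhds w. max (u y) (s y) = ?v y"
      using 1 unfolding eventually_nhds by (intro exI[of _ "ball a \<rho>"]) auto
    ultimately show ?thesis by (rule subharmonic_at_cong[rotated])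
  next
    case 2
    then have "\<forall>\<^sub>F y in nhds w. u y = ?v y"
      unfolding eventually_nhds by (intro exI[of _ "- cball a \<rho>"]) auto
    then show ?thesis using uw by (rule subharmonic_at_cong)
  next
    case 3
    then have vw: "?v w = u w" and sw: "s w \<le> u w" using le[of w] w by auto
    have uv: "u x \<le> ?v x" for x by simp
    obtain r0 where "r0 > 0" "\<forall>r. 0 < r \<and> r < r0 \<longrightarrow> u w \<le> circle_mean u w r"
      using uw unfolding subharmonic_at_def by blast
    then have m: "\<exists>\<rho>>0. \<forall>r. 0 < r \<and> r < \<rho> \<longrightarrow> ?v w \<le> circle_mean ?v w r"
      unfolding vw using circle_mean_mono[of w _ u ?v, OF uv]
      by (meson less_imp_le order_trans)
    have n: "\<forall>\<^sub>F y in nhds w. ?v y < c" if c: "?v w < c" for c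
    proof -
      have "u w < c" "s w < c" using c sw unfolding vw by auto
      have 1: "\<forall>\<^sub>F y in nhds w. u y < c" using \<open>u w < c\<close> uw unfolding subharmonic_at_def by auto
      have "w \<in> S \<inter> cball a \<rho>" using w 3 by auto
      then have "\<forall>\<^sub>F y in at w within (S \<inter> cball a \<rho>). s y < c"
        using s(1) \<open>s w < c\<close> unfolding usc_on_def by blast
      then have "\<forall>\<^sub>F y in nhds w. y \<noteq> w \<longrightarrow> y \<in> S \<inter> cball a \<rho> \<longrightarrow> s y < c"
        unfolding eventually_at_filter .
      then have 2: "\<forall>\<^sub>F y in nhds w. y \<in> S \<inter> cball a \<rho> \<longrightarrow> s y < c"
        by eventually_elim (use \<open>s w < c\<close> in auto)
      have 3: "\<forall>\<^sub>F y in nhds w. y \<in> S" using S w eventually_nhds by blast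
      show ?thesis using 1 2 3 by eventually_elim auto
    qed
    have "?v w < \<infinity>" using uw unfolding vw subharmonic_at_def by blast
    then show ?thesis unfolding subharmonic_at_def using m n by blast
  qed
qed

text \<open>Perturbing by \<open>\<epsilon>|z|\<^sup>2\<close> makes the sub-mean value inequality strict, so an interior maximum is impossible.\<close>

lemma subharmonic_maximum_principle:
  assumes \<Omega>: "open \<Omega>" "bounded \<Omega>" and usc: "usc_on (closure \<Omega>) u" and u: "subharmonic_on \<Omega> u"
    and g: "continuous_on (closure \<Omega>) g"
    and harm: "\<And>a. a \<in> \<Omega> \<Longrightarrow> \<exists>R>0. \<exists>F. F holomorphic_on ball a R \<and> (\<forall>w\<in>ball a R. g w = Re (F w))"
    and bd: "\<And>x. x \<in> frontier \<Omega> \<Longrightarrow> u x \<le> ereal (g x)"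
    and x: "x \<in> closure \<Omega>"
  shows "u x \<le> ereal (g x)"
proof (rule ccontr)
  assume neg: "\<not> u x \<le> ereal (g x)"
  have fr: "closure \<Omega> = \<Omega> \<union> frontier \<Omega>" 
    using \<Omega>(1) by (metis closure_Un_frontier)
  have xO: "x \<in> \<Omega>" using x bd neg fr by blast
  have fin: "u y < \<infinity>" if "y \<in> closure \<Omega>" for y
  proof (cases "y \<in> \<Omega>")
    case True then show ?thesis using u unfolding subharmonic_on_def by auto
  next
    case False then have "u y \<le> ereal (g y)" using that fr bd by blast
    then show ?thesis by (cases "u y") auto
  qed
  have "u x \<noteq> -\<infinity>" using neg by auto
  then obtain ux where ux: "u x = ereal ux" using fin[OF x] by (cases "u x") auto
  have d: "ux - g x > 0" using neg ux by simp
  obtain B where B: "B > 0" "\<And>y. y \<in> closure \<Omega> \<Longrightarrow> norm y \<le> B"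
    using bounded_closure[OF \<Omega>(2)] unfolding bounded_pos by auto
  \<comment> \<open>On the closure the perturbation then stays below \<epsilon>B^2, half the excess
    of \<open>u\<close> over \<open>g\<close> at \<open>x\<close>, so a maximum of \<psi> cannot lie
    on the frontier.\<close>
  define \<epsilon> where "\<epsilon> = (ux - g x) / (2 * B\<^sup>2)"
  have \<epsilon>: "\<epsilon> > 0" "\<epsilon> * B\<^sup>2 < ux - g x" using d B by (auto simp: \<epsilon>_def)
  define \<psi> where "\<psi> = (\<lambda>y. u y + ereal (\<epsilon> * (norm y)\<^sup>2 - g y))"
  have "usc_on (closure \<Omega>) \<psi>"
    unfolding \<psi>_def using usc fin g
    by (intro usc_on_add usc_on_continuous continuous_intros) auto
  moreover have "compact (closure \<Omega>)" using \<Omega> by (simp add: compact_closure)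
  ultimately obtain a where a: "a \<in> closure \<Omega>" "\<And>y. y \<in> closure \<Omega> \<Longrightarrow> \<psi> y \<le> \<psi> a"
    using usc_on_attains_sup x by (metis empty_iff)
  have "\<psi> x = ereal (ux - g x + \<epsilon> * (norm x)\<^sup>2)" by (simp add: \<psi>_def ux)
  also have "\<dots> > ereal (\<epsilon> * B\<^sup>2)" using \<epsilon> by (simp add: add_strict_increasing2 add.commute less_le_trans[OF \<epsilon>(2)])
  finally have big: "\<psi> a > ereal (\<epsilon> * B\<^sup>2)" using a(2)[OF x] by simp
  then obtain c where c: "\<psi> a = ereal c" using fin[OF a(1)] unfolding \<psi>_def by (cases "u a") auto
  have "a \<in> \<Omega>"
  proof (rule ccontr)
    assume "a \<notin> \<Omega>"
    then have "u a \<le> ereal (g a)" using a fr bd by blast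
    then have "\<psi> a \<le> ereal (g a) + ereal (\<epsilon> * (norm a)\<^sup>2 - g a)" unfolding \<psi>_def by (rule add_right_mono)
    also have "\<dots> = ereal (\<epsilon> * (norm a)\<^sup>2)" by simp
    also have "\<dots> \<le> ereal (\<epsilon> * B\<^sup>2)" using B(2)[OF a(1)] \<epsilon> by (auto intro!: mult_left_mono power_mono)
    finally show False using big by simp
  qed
  then obtain R F where R: "R > 0" "F holomorphic_on ball a R" "\<forall>w\<in>ball a R. g w = Re (F w)"
    using harm by blast
  obtain \<rho> where \<rho>: "\<rho> > 0" "cball a \<rho> \<subseteq> \<Omega>" "\<And>r. 0 < r \<Longrightarrow> r < \<rho> \<Longrightarrow> u a \<le> circle_mean u a r"
    using u \<open>a \<in> \<Omega>\<close> unfolding subharmonic_on_def by metis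
  define r where "r = min \<rho> R / 2"
  have r: "0 < r" "r < \<rho>" "r < R" using R \<rho> by (auto simp: r_def)
  \<comment> \<open>On the circle of radius \<open>r\<close> about \<open>a\<close>, |y|^2 = |a|^2 +
    r^2 + 2 Re (cnj a (y - a)). Hence the bound c + g - \<epsilon>|y|^2 for \<open>u\<close>
    coincides there with the real part of a holomorphic function, whose mean is known.\<close>
  define G where "G = (\<lambda>w. F w + of_real (c - \<epsilon> * ((norm a)\<^sup>2 + r\<^sup>2)) - of_real (2 * \<epsilon>) * cnj a * (w - a))"
  have G: "G holomorphic_on ball a R"
    unfolding G_def by (intro holomorphic_intros R)
  have "u y \<le> ereal (Re (G y))" if y: "y \<in> sphere a r" for y
  proof -
    have "y \<in> \<Omega>" "y \<in> ball a R" using y r \<rho> by auto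
    have "norm (y - a) = r" using y by (simp add: dist_norm norm_minus_commute)
    moreover have "(norm y)\<^sup>2 = (norm a)\<^sup>2 + (norm (y - a))\<^sup>2 + 2 * Re (cnj a * (y - a))"
      unfolding cmod_power2 by (simp add: power2_eq_square algebra_simps)
    ultimately have "\<epsilon> * (norm y)\<^sup>2 = \<epsilon> * ((norm a)\<^sup>2 + r\<^sup>2) + 2 * \<epsilon> * Re (cnj a * (y - a))"
      by (simp only: distrib_left mult.assoc mult.left_commute)
    then have G_eq: "Re (G y) = c + g y - \<epsilon> * (norm y)\<^sup>2"
      using R(3) \<open>y \<in> ball a R\<close> by (simp add: G_def algebra_simps)
    have "\<psi> y \<le> ereal c" using a(2)[of y] c \<open>y \<in> \<Omega>\<close> closure_subset by auto
    then show ?thesis unfolding G_eq \<psi>_def by (cases "u y") auto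
  qed
  then have "circle_mean u a r \<le> circle_mean (\<lambda>y. ereal (Re (G y))) a r"
    using r by (intro circle_mean_mono) auto
  also have "\<dots> = ereal (Re (G a))"
    using G r(1,3) by (rule circle_mean_Re_holomorphic)
  finally have "u a \<le> ereal (Re (G a))" using \<rho>(3)[of r] r by simp
  moreover have "Re (G a) = c + g a - \<epsilon> * (norm a)\<^sup>2 - \<epsilon> * r\<^sup>2"
    using R by (simp add: G_def algebra_simps)
  moreover have "u a = ereal (c + g a - \<epsilon> * (norm a)\<^sup>2)"
    using c unfolding \<psi>_def by (cases "u a") auto
  \<comment> \<open>The mean falls short of \<open>u a\<close> by exactly this amount.\<close>
  moreover have "\<epsilon> * r\<^sup>2 > 0" using \<epsilon> r by simp
  ultimately show False by simp
qed

subsection \<open>Poisson integrals of upper semicontinuous functions\<close>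

text \<open>The Cayley-type map (P - B) / (P + cnj B) sends the right half-plane into the unit disc
  and the central value \<open>B\<close> to 0, so Schwarz's lemma bounds it by 1/2 on the half disc.
  The triangle inequality then gives |P - B| \<le> 2 Re B, whence the factor 1 + 2 = 3.\<close>

lemma Harnack_half_ball:
  assumes F: "F holomorphic_on ball x R" and nn: "\<And>y. y \<in> ball x R \<Longrightarrow> 0 \<le> Re (F y)"
    and R: "R > 0" and w: "w \<in> cball x (R/2)"
  shows "Re (F w) \<le> 3 * Re (F x)"
proof -
  \<comment> \<open>Adding \<delta> makes the real part strictly positive, which keeps the
    denominator of the Cayley map away from 0 even if Re F vanishes.\<close>
  have key: "Re (F w) \<le> 3 * Re (F x) + 2 * \<delta>" if \<delta>: "\<delta> > 0" for \<delta>
  proof -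
    define P where "P = (\<lambda>\<zeta>. F (x + of_real R * \<zeta>) + of_real \<delta>)"
    define B where "B = F x + of_real \<delta>"
    have in_ball: "x + of_real R * \<zeta> \<in> ball x R" if "norm \<zeta> < 1" for \<zeta>
      using R that by (simp add: dist_norm norm_mult)
    have P: "Re (P \<zeta>) > 0" if "norm \<zeta> < 1" for \<zeta>
      using nn[OF in_ball[OF that]] \<delta> by (simp add: P_def)
    have B: "Re B > 0" using nn[of x] R \<delta> by (simp add: B_def)
    have lt: "norm (A - B) < norm (A + cnj B)" if "Re A > 0" for A
    proof -
      have "(norm (A - B))\<^sup>2 < (norm (A + cnj B))\<^sup>2"
        unfolding cmod_power2 using mult_pos_pos[OF that B] by (simp add: power2_eq_square algebra_simps)
      then show ?thesis by (rule power_less_imp_less_base) simp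
    qed
    define g where "g = (\<lambda>\<zeta>. (P \<zeta> - B) / (P \<zeta> + cnj B))"
    have nz: "P \<zeta> + cnj B \<noteq> 0" if "norm \<zeta> < 1" for \<zeta>
      using lt[OF P[OF that]] by auto
    have "(\<lambda>\<zeta>. F (x + of_real R * \<zeta>)) holomorphic_on ball 0 1"
      by (rule holomorphic_on_compose_gen[of "\<lambda>\<zeta>. x + of_real R * \<zeta>" "ball 0 1" F "ball x R", unfolded o_def])
        (use F in_ball in \<open>auto intro!: holomorphic_intros\<close>)
    then have g: "g holomorphic_on ball 0 1"
      unfolding g_def P_def by (intro holomorphic_intros) (use nz in \<open>auto simp: P_def\<close>)
    have g0: "g 0 = 0" by (simp add: g_def P_def B_def)
    have g1: "norm (g \<zeta>) < 1" if "norm \<zeta> < 1" for \<zeta>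
      using lt[OF P[OF that]] by (simp add: g_def norm_divide divide_simps)
    define \<zeta> where "\<zeta> = (w - x) / of_real R"
    have \<zeta>: "norm \<zeta> \<le> 1/2" using w R by (simp add: \<zeta>_def norm_divide dist_norm norm_minus_commute divide_simps)
    have Pw: "P \<zeta> = F w + of_real \<delta>" using R by (simp add: P_def \<zeta>_def)
    have "norm (g \<zeta>) \<le> 1/2"
      using Schwarz_Lemma(1)[OF g g0 g1, of \<zeta>] \<zeta> by simp
    then have "norm (P \<zeta> - B) \<le> norm (P \<zeta> + cnj B) / 2"
      using nz[of \<zeta>] \<zeta> by (simp add: g_def norm_divide divide_simps)
    moreover have "norm (P \<zeta> + cnj B) \<le> norm (P \<zeta> - B) + norm (B + cnj B)"
      using norm_triangle_ineq[of "P \<zeta> - B" "B + cnj B"] by (simp add: algebra_simps)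
    moreover have "norm (B + cnj B) = 2 * Re B"
      using B by (simp add: complex_add_cnj norm_mult)
    ultimately have "norm (P \<zeta> - B) \<le> 2 * Re B" by linarith
    then have "Re (P \<zeta>) \<le> 3 * Re B"
      using complex_Re_le_cmod[of "P \<zeta> - B"] by simp
    then show ?thesis by (simp add: Pw B_def)
  qed
  show ?thesis
  proof (rule field_le_epsilon)
    fix e :: real assume "e > 0"
    then show "Re (F w) \<le> 3 * Re (F x) + e" using key[of "e/2"] by simp
  qed
qed

text \<open>Trigonometric polynomials on the unit circle, given by formulas on the whole plane that
  are real parts of polynomials. Every identity proved on the circle thus comes with an entire
  harmonic extension. Nonnegative powers suffice, since conjugation leaves real parts
  unchanged.\<close>

inductive trig_poly :: "(complex \<Rightarrow> real) \<Rightarrow> bool" where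
  monom: "trig_poly (\<lambda>w. Re (a * w ^ k))"
| add: "trig_poly f \<Longrightarrow> trig_poly g \<Longrightarrow> trig_poly (\<lambda>w. f w + g w)"

text \<open>2 Re X Re Y = Re (X Y) + Re (X cnj Y), and on the unit circle cnj w is the inverse of w.
  With the larger exponent in X, the product X cnj Y is again a monomial.\<close>

lemma trig_poly_monom_mult:
  "\<exists>h. trig_poly h \<and> (\<forall>w\<in>sphere 0 1. h w = Re (a * w ^ j) * Re (b * w ^ k))"
proof -
  have *: "\<exists>h. trig_poly h \<and> (\<forall>w\<in>sphere 0 1. h w = Re (a * w ^ (k + l)) * Re (b * w ^ k))" for a b k l
  proof (intro exI conjI ballI)
    show "trig_poly (\<lambda>w. Re (a * b / 2 * w ^ (k + l + k)) + Re (a * cnj b / 2 * w ^ l))"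
      by (intro trig_poly.intros)
    fix w :: complex assume "w \<in> sphere 0 1"
    then have "w * cnj w = 1" by (simp add: complex_norm_square[symmetric])
    then have "w ^ k * cnj w ^ k = 1" by (metis power_mult_distrib power_one)
    then have e: "a * w ^ (k + l) * cnj (b * w ^ k) = a * cnj b * w ^ l"
      by (simp add: power_add mult.assoc mult.left_commute[of "w ^ l"])
    have "Re X * Re Y = Re (X * Y) / 2 + Re (X * cnj Y) / 2" for X Y by (simp add: field_simps)
    from this[of "a * w ^ (k + l)" "b * w ^ k"]
    have "Re (a * w ^ (k + l)) * Re (b * w ^ k) = Re (a * w ^ (k + l) * (b * w ^ k)) / 2 + Re (a * cnj b * w ^ l) / 2"
      unfolding e .
    also have "a * w ^ (k + l) * (b * w ^ k) = a * b * w ^ (k + l + k)"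
      unfolding power_add by algebra
    also have "Re (a * b * w ^ (k + l + k)) / 2 = Re (a * b / 2 * w ^ (k + l + k))"
      by (metis Re_divide_numeral times_divide_eq_left)
    also have "Re (a * cnj b * w ^ l) / 2 = Re (a * cnj b / 2 * w ^ l)"
      by (metis Re_divide_numeral times_divide_eq_left)
    finally show "Re (a * b / 2 * w ^ (k + l + k)) + Re (a * cnj b / 2 * w ^ l) = Re (a * w ^ (k + l)) * Re (b * w ^ k)"
      by (rule sym)
  qed
  show ?thesis
  proof (cases "k \<le> j")
    case True then show ?thesis using *[of a k "j - k" b] by simp
  next
    case False then show ?thesis using *[of b j "k - j" a] by (simp add: mult.commute)
  qed
qed

lemma trig_poly_mult:
  assumes "trig_poly f" "trig_poly g"
  shows "\<exists>h. trig_poly h \<and> (\<forall>w\<in>sphere 0 1. h w = f w * g w)"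
  using assms
proof (induction f rule: trig_poly.induct)
  case (monom a k)
  from monom show ?case
  proof (induction g rule: trig_poly.induct)
    case (monom b j) then show ?case by (rule trig_poly_monom_mult)
  next
    case (add f g)
    then obtain h1 h2 where "trig_poly h1" "trig_poly h2" "\<forall>w\<in>sphere 0 1. h1 w = Re (a * w ^ k) * f w"
      "\<forall>w\<in>sphere 0 1. h2 w = Re (a * w ^ k) * g w" by blast
    then show ?case
      by (intro exI[of _ "\<lambda>w. h1 w + h2 w"]) (auto intro: trig_poly.intros simp: distrib_left)
  qed
next
  case (add f1 f2)
  then obtain h1 h2 where "trig_poly h1" "trig_poly h2" "\<forall>w\<in>sphere 0 1. h1 w = f1 w * g w"
    "\<forall>w\<in>sphere 0 1. h2 w = f2 w * g w" by blast
  then show ?case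
    by (intro exI[of _ "\<lambda>w. h1 w + h2 w"]) (auto intro: trig_poly.intros simp: distrib_right)
qed

lemma trig_poly_entire: "trig_poly f \<Longrightarrow> \<exists>F. F holomorphic_on UNIV \<and> (\<forall>w. f w = Re (F w))"
proof (induction rule: trig_poly.induct)
  case (monom a k)
  then show ?case by (intro exI[of _ "\<lambda>w. a * w ^ k"]) (auto intro!: holomorphic_intros)
next
  case (add f g)
  then obtain F G where "F holomorphic_on UNIV" "G holomorphic_on UNIV" "\<forall>w. f w = Re (F w)" "\<forall>w. g w = Re (G w)"
    by blast
  then show ?case by (intro exI[of _ "\<lambda>w. F w + G w"]) (auto intro!: holomorphic_intros)
qed

lemma real_polynomial_function_trig_poly:
  fixes p :: "complex \<Rightarrow> real"
  assumes "real_polynomial_function p"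
  shows "\<exists>h. trig_poly h \<and> (\<forall>w\<in>sphere 0 1. h w = p w)"
  using assms
proof (induction rule: real_polynomial_function.induct)
  case (linear f)
  then have lin: "linear f" by (rule bounded_linear.linear)
  \<comment> \<open>A real-linear functional is the real part of multiplication by f 1 - \<i> f
    \<i>.\<close>
  have *: "Re (Complex (f 1) (- f \<i>) * w ^ 1) = f w" for w
  proof -
    have "w = Re w *\<^sub>R 1 + Im w *\<^sub>R \<i>" by (simp add: complex_eq_iff)
    then have "f w = f (Re w *\<^sub>R 1 + Im w *\<^sub>R \<i>)" by (rule arg_cong)
    also have "\<dots> = Re w * f 1 + Im w * f \<i>" by (simp only: linear_add[OF lin] linear_scale[OF lin] real_scaleR_def)
    also have "\<dots> = Re (Complex (f 1) (- f \<i>) * w ^ 1)" by (simp only: power_one_right mult.commute times_complex.sel complex.sel)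
    finally show ?thesis by (rule sym)
  qed
  show ?case using trig_poly.monom[of "Complex (f 1) (- f \<i>)" 1] * by blast
next
  case (const c)
  show ?case using trig_poly.monom[of "of_real c" 0] by (intro exI[of _ "\<lambda>w. Re (of_real c * w ^ 0)"]) simp
next
  case (add f g)
  then obtain h1 h2 where "trig_poly h1" "trig_poly h2" "\<forall>w\<in>sphere 0 1. h1 w = f w" "\<forall>w\<in>sphere 0 1. h2 w = g w"
    by blast
  then show ?case
    by (intro exI[of _ "\<lambda>w. h1 w + h2 w"]) (auto intro: trig_poly.intros)
next
  case (mult f g)
  then obtain h1 h2 where "trig_poly h1" "trig_poly h2" "\<forall>w\<in>sphere 0 1. h1 w = f w" "\<forall>w\<in>sphere 0 1. h2 w = g w"
    by blast
  then show ?case using trig_poly_mult[of h1 h2] by auto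
qed

text \<open>Stone-Weierstrass gives a polynomial in the two real coordinates; on the circle it is a
  trigonometric polynomial, hence the real part of an entire function. This solves the Dirichlet
  problem on a disc up to an arbitrarily small error.\<close>

lemma Re_entire_approximation_on_circle:
  assumes \<phi>: "continuous_on (sphere z \<rho>) \<phi>" and \<rho>: "\<rho> > 0" and e: "e > 0"
  obtains F where "F holomorphic_on UNIV" "\<And>x. x \<in> sphere z \<rho> \<Longrightarrow> \<bar>\<phi> x - Re (F x)\<bar> < e"
proof -
  have "continuous_on (sphere 0 1) (\<lambda>\<zeta>. \<phi> (z + of_real \<rho> * \<zeta>))"
    by (intro continuous_on_compose2[OF \<phi>] continuous_intros) (use \<rho> in \<open>auto simp: dist_norm norm_mult\<close>)
  then obtain p where p: "real_polynomial_function p" "\<And>\<zeta>. \<zeta> \<in> sphere 0 1 \<Longrightarrow> \<bar>\<phi> (z + of_real \<rho> * \<zeta>) - p \<zeta>\<bar> < e"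
    using Stone_Weierstrass_real_polynomial_function[OF compact_sphere _ e] by metis
  obtain G where G: "G holomorphic_on UNIV" "\<And>\<zeta>. \<zeta> \<in> sphere 0 1 \<Longrightarrow> p \<zeta> = Re (G \<zeta>)"
    using real_polynomial_function_trig_poly[OF p(1)] trig_poly_entire by metis
  show ?thesis
  proof
    show "(\<lambda>x. G ((x - z) / of_real \<rho>)) holomorphic_on UNIV"
      by (rule holomorphic_on_compose_gen[of "\<lambda>x. (x - z) / of_real \<rho>" UNIV G UNIV, unfolded o_def])
        (use G \<rho> in \<open>auto intro!: holomorphic_intros\<close>)
    fix x assume "x \<in> sphere z \<rho>"
    then have "(x - z) / of_real \<rho> \<in> sphere 0 1"
      using \<rho> by (simp add: dist_norm norm_minus_commute norm_divide)
    from p(2)[OF this] G(2)[OF this] show "\<bar>\<phi> x - Re (G ((x - z) / of_real \<rho>))\<bar> < e"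
      using \<rho> by simp
  qed
qed

text \<open>Sup-convolution: G n x is the supremum over y of \<phi>_n(y) - n |x - y|. It is
  n-Lipschitz and lies above \<open>f\<close>; the growing penalty makes it decrease to
  \<open>f\<close>.\<close>

lemma usc_on_decreasing_continuous:
  assumes S: "S \<noteq> {}" and usc: "usc_on S f" and le: "\<And>x. x \<in> S \<Longrightarrow> f x \<le> ereal M"
  obtains G :: "nat \<Rightarrow> complex \<Rightarrow> real"
  where "\<And>n. continuous_on S (G n)" "\<And>n x. x \<in> S \<Longrightarrow> G (Suc n) x \<le> G n x"
    "\<And>n x. x \<in> S \<Longrightarrow> f x \<le> ereal (G n x)" "\<And>n x. x \<in> S \<Longrightarrow> G n x \<le> M"
    "\<And>x. x \<in> S \<Longrightarrow> (INF n. ereal (G n x)) \<le> f x"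
proof -
  \<comment> \<open>The floor M - n makes the regularised function real even where \<open>f\<close>
    is -\<infinity>, and it disappears in the limit.\<close>
  define \<phi> where "\<phi> = (\<lambda>n y. real_of_ereal (max (f y) (ereal (M - real n))))"
  have \<phi>: "ereal (\<phi> n y) = max (f y) (ereal (M - real n))" if "y \<in> S" for n y
    using le[OF that] by (cases "f y") (auto simp: \<phi>_def max_def)
  have \<phi>_le: "\<phi> n y \<le> M" if "y \<in> S" for n y
  proof -
    have "ereal (\<phi> n y) \<le> ereal M" unfolding \<phi>[OF that] using le[OF that] by simp
    then show ?thesis by simp
  qed
  have \<phi>_dec: "\<phi> (Suc n) y \<le> \<phi> n y" if "y \<in> S" for n y
  proof -
    have "ereal (\<phi> (Suc n) y) \<le> ereal (\<phi> n y)" unfolding \<phi>[OF that] by (intro max.mono) auto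
    then show ?thesis by simp
  qed
  define G where "G = (\<lambda>n x. SUP y\<in>S. \<phi> n y - real n * dist x y)"
  have le_M: "\<phi> n y - real n * dist x y \<le> M" if "y \<in> S" for n x y
  proof -
    have "0 \<le> real n * dist x y" by simp
    then show ?thesis using \<phi>_le[OF that, of n] by linarith
  qed
  then have bdd: "bdd_above ((\<lambda>y. \<phi> n y - real n * dist x y) ` S)" for n x
    by (auto intro!: bdd_aboveI[of _ M])
  have up: "\<phi> n y - real n * dist x y \<le> G n x" if "y \<in> S" for n x y
    unfolding G_def using bdd that by (rule cSUP_upper2) simp
  have lip: "G n x \<le> G n x' + real n * dist x x'" for n x x'
  proof -
    have "\<phi> n y - real n * dist x y \<le> G n x' + real n * dist x x'" if y: "y \<in> S" for y
    proof -
      have "real n * dist x' y \<le> real n * (dist x x' + dist x y)"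
        by (intro mult_left_mono dist_triangle3) auto
      then show ?thesis
        using up[OF y, of n x'] by (simp add: algebra_simps)
    qed
    then show ?thesis unfolding G_def by (intro cSUP_least[OF S]) (simp add: G_def)
  qed
  show ?thesis
  proof
    fix n
    have "(real n)-lipschitz_on S (G n)"
    proof (rule lipschitz_onI)
      fix x x'
      show "dist (G n x) (G n x') \<le> real n * dist x x'"
        using lip[of n x x'] lip[of n x' x] by (simp add: dist_real_def dist_commute abs_le_iff)
    qed simp
    then show "continuous_on S (G n)" by (rule lipschitz_on_continuous_on)
  next
    fix n x assume x: "x \<in> S"
    show "G n x \<le> M" unfolding G_def using le_M by (intro cSUP_least[OF S])
    have "f x \<le> ereal (\<phi> n x)" unfolding \<phi>[OF x] by simp
    also have "\<dots> \<le> ereal (G n x)" using up[OF x, of n x] by simp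
    finally show "f x \<le> ereal (G n x)" .
    have "\<phi> (Suc n) y - real (Suc n) * dist x y \<le> G n x" if y: "y \<in> S" for y
    proof -
      have "real n * dist x y \<le> real (Suc n) * dist x y" by (intro mult_right_mono) auto
      then show ?thesis using up[OF y, of n x] \<phi>_dec[OF y, of n] by linarith
    qed
    then show "G (Suc n) x \<le> G n x" unfolding G_def by (intro cSUP_least[OF S]) (simp add: G_def)
  next
    fix x assume x: "x \<in> S"
    show "(INF n. ereal (G n x)) \<le> f x"
    proof (rule dense_ge)
      fix c assume c: "f x < c"
      show "(INF n. ereal (G n x)) \<le> c"
      proof (cases c)
        case (real c')
        have "\<forall>\<^sub>F y in at x within S. f y < c" using usc x c unfolding usc_on_def by blast
        then obtain \<delta> where \<delta>: "\<delta> > 0" "\<And>y. y \<in> S \<Longrightarrow> y \<noteq> x \<Longrightarrow> dist y x < \<delta> \<Longrightarrow> f y < c"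
          unfolding eventually_at by blast
        \<comment> \<open>The first bound puts the floor M - n below \<open>c'\<close>, for points y
          near x; the second makes the penalty at distance \<delta> at least M - c', for the
          others.\<close>
        obtain n where n: "real n \<ge> max (M - c') ((M - c') / \<delta>)" using real_arch_simple by blast
        then have n\<delta>: "M - real n * \<delta> \<le> c'" using \<delta> by (simp add: divide_simps algebra_simps)
        have "\<phi> n y - real n * dist x y \<le> c'" if y: "y \<in> S" for y
        proof (cases "dist y x < \<delta>")
          case True
          then have "f y < c" using \<delta>(2)[OF y] c by (cases "y = x") auto
          then have "ereal (\<phi> n y) \<le> ereal c'" unfolding \<phi>[OF y] using real n by auto
          moreover have "0 \<le> real n * dist x y" by simp
          ultimately show ?thesis unfolding ereal_less_eq by linarith
        next
          case False
          then have "real n * \<delta> \<le> real n * dist x y" by (intro mult_left_mono) (auto simp: dist_commute)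
          then show ?thesis using n\<delta> \<phi>_le[OF y, of n] by linarith
        qed
        then have "G n x \<le> c'" unfolding G_def by (intro cSUP_least[OF S])
        then show ?thesis unfolding real by (intro INF_lower2[of n]) auto
      qed (use c in auto)
    qed
  qed
qed

lemma ereal_le_from_halves:
  assumes "\<And>n. n \<ge> N \<Longrightarrow> a \<le> ereal (b + C / 2 ^ n)"
  shows "a \<le> ereal b"
proof (rule LIMSEQ_le_const)
  have "(\<lambda>n. b + C / 2 ^ n) \<longlonglongrightarrow> b + 0"
    by (intro tendsto_add tendsto_const LIMSEQ_divide_realpow_zero) auto
  then show "(\<lambda>n. ereal (b + C / 2 ^ n)) \<longlonglongrightarrow> ereal b" by simp
qed (use assms in blast)

lemma subharmonic_le_Re_entire:
  assumes "\<rho> > 0" "usc_on (cball z \<rho>) u" "subharmonic_on (ball z \<rho>) u" "F holomorphic_on UNIV"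
    and "\<And>x. x \<in> sphere z \<rho> \<Longrightarrow> u x \<le> ereal (Re (F x))" and "x \<in> cball z \<rho>"
  shows "u x \<le> ereal (Re (F x))"
proof (rule subharmonic_maximum_principle[where \<Omega>="ball z \<rho>" and g="\<lambda>x. Re (F x)"])
  show "continuous_on (closure (ball z \<rho>)) (\<lambda>x. Re (F x))"
    using holomorphic_on_imp_continuous_on[OF assms(4)] continuous_on_subset by (intro continuous_intros) blast
  show "\<exists>R>0. \<exists>H. H holomorphic_on ball a R \<and> (\<forall>w\<in>ball a R. Re (F w) = Re (H w))" for a
    using holomorphic_on_subset[OF assms(4)] by (intro exI[of _ 1] conjI exI[of _ F]) auto
qed (use assms in auto)

text \<open>The Poisson integral of an upper semicontinuous boundary function, obtained without the Poisson
  kernel as a decreasing limit of real parts of entire functions.\<close>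

lemma Poisson_extension_usc:
  assumes \<rho>: "\<rho> > 0" and usc: "usc_on (sphere z \<rho>) f" and le: "\<And>x. x \<in> sphere z \<rho> \<Longrightarrow> f x \<le> ereal M"
  obtains h where "usc_on (cball z \<rho>) h" "subharmonic_on (ball z \<rho>) h"
    "\<And>x. x \<in> sphere z \<rho> \<Longrightarrow> h x = f x" "\<And>x. x \<in> cball z \<rho> \<Longrightarrow> h x \<le> ereal M"
    "circle_mean f z \<rho> \<le> h z"
    "\<And>u x. usc_on (cball z \<rho>) u \<Longrightarrow> subharmonic_on (ball z \<rho>) u \<Longrightarrow>
      (\<forall>y\<in>sphere z \<rho>. u y \<le> f y) \<Longrightarrow> x \<in> cball z \<rho> \<Longrightarrow> u x \<le> h x"
    "\<And>x w R. R > 0 \<Longrightarrow> ball x R \<subseteq> ball z \<rho> \<Longrightarrow> w \<in> cball x (R/2) \<Longrightarrow> 3 * h x - ereal (2 * M) \<le> h w"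
proof -
  have ne: "sphere z \<rho> \<noteq> {}" using \<rho> by simp
  obtain G :: "nat \<Rightarrow> complex \<Rightarrow> real" where G:
    "\<And>n. continuous_on (sphere z \<rho>) (G n)" "\<And>n x. x \<in> sphere z \<rho> \<Longrightarrow> G (Suc n) x \<le> G n x"
    "\<And>n x. x \<in> sphere z \<rho> \<Longrightarrow> f x \<le> ereal (G n x)" "\<And>n x. x \<in> sphere z \<rho> \<Longrightarrow> G n x \<le> M"
    "\<And>x. x \<in> sphere z \<rho> \<Longrightarrow> (INF n. ereal (G n x)) \<le> f x"
  proof (rule usc_on_decreasing_continuous[OF ne usc])
    show "f x \<le> ereal M" if "x \<in> sphere z \<rho>" for x using le that .
  qed (rule that)
  \<comment> \<open>Shift 3 with error 1 places Re (F n) between G n + 2/2^n and G n + 4/2^n. As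
    4/2^(n+1) = 2/2^n, these bands are stacked and the sequence decreases on the circle, hence on
    the disc.\<close>
  have "\<exists>F. F holomorphic_on UNIV \<and> (\<forall>x\<in>sphere z \<rho>. \<bar>(G n x + 3 / 2 ^ n) - Re (F x)\<bar> < 1 / 2 ^ n)" for n
  proof -
    have c: "continuous_on (sphere z \<rho>) (\<lambda>x. G n x + 3 / 2 ^ n)"
      by (intro continuous_intros G)
    have p: "(0::real) < 1 / 2 ^ n" by simp
    obtain H where "H holomorphic_on UNIV" "\<And>x. x \<in> sphere z \<rho> \<Longrightarrow> \<bar>(G n x + 3 / 2 ^ n) - Re (H x)\<bar> < 1 / 2 ^ n"
      by (rule Re_entire_approximation_on_circle[OF c \<rho> p]) (rule that)
    then show ?thesis by blast
  qed
  then obtain F where F: "\<And>n. F n holomorphic_on UNIV"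
    "\<And>n x. x \<in> sphere z \<rho> \<Longrightarrow> \<bar>(G n x + 3 / 2 ^ n) - Re (F n x)\<bar> < 1 / 2 ^ n" by metis
  have F_lo: "G n x + 2 / 2 ^ n \<le> Re (F n x)" and F_hi: "Re (F n x) \<le> G n x + 4 / 2 ^ n"
    if "x \<in> sphere z \<rho>" for n x
    using F(2)[OF that, of n] by (simp_all add: abs_less_iff field_simps)
  have contF: "continuous_on A (\<lambda>x. Re (F n x))" for A n
    using holomorphic_on_imp_continuous_on[OF F(1)] continuous_on_subset by (intro continuous_intros) blast
  have shF: "subharmonic_on A (\<lambda>x. ereal (Re (F n x)))" if "open A" for A n
    unfolding subharmonic_on_iff[OF that] subharmonic_at_def
  proof (intro ballI conjI allI impI)
    fix w show "\<exists>\<rho>>0. \<forall>r. 0 < r \<and> r < \<rho> \<longrightarrow> ereal (Re (F n w)) \<le> circle_mean (\<lambda>x. ereal (Re (F n x))) w r"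
      using circle_mean_Re_holomorphic[of "F n" w 1] holomorphic_on_subset[OF F(1)]
      by (intro exI[of _ 1]) auto
    fix c assume "ereal (Re (F n w)) < c"
    then show "\<forall>\<^sub>F y in nhds w. ereal (Re (F n y)) < c"
      using usc_on_continuous[OF contF[of UNIV n]] by (auto simp: usc_on_def eventually_nhds_conv_at)
  qed simp
  have uscF: "usc_on A (\<lambda>x. ereal (Re (F n x)))" for A n
    by (intro usc_on_continuous contF)
  have decF: "Re (F (Suc n) x) \<le> Re (F n x)" if x: "x \<in> cball z \<rho>" for n x
  proof -
    have "Re (F (Suc n) y) \<le> Re (F n y)" if "y \<in> sphere z \<rho>" for y
    proof -
      have "4 / 2 ^ Suc n = (2 / 2 ^ n :: real)" by simp
      then show ?thesis
        using F_hi[OF that, of "Suc n"] F_lo[OF that, of n] G(2)[OF that, of n] by linarith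
    qed
    then have "ereal (Re (F (Suc n) x)) \<le> ereal (Re (F n x))"
      by (intro subharmonic_le_Re_entire[OF \<rho> uscF shF[OF open_ball] F(1) _ x]) simp
    then show ?thesis by simp
  qed
  have decF': "Re (F m x) \<le> Re (F n x)" if "x \<in> cball z \<rho>" "n \<le> m" for n m x
    by (rule lift_Suc_antimono_le[of "\<lambda>n. Re (F n x)", OF decF[OF that(1)] that(2)])
  have F_le: "Re (F n x) \<le> M + 4 / 2 ^ n" if x: "x \<in> cball z \<rho>" for n x
  proof -
    have "Re (F n y) \<le> M + 4 / 2 ^ n" if "y \<in> sphere z \<rho>" for y
      using F_hi[OF that, of n] G(4)[OF that, of n] by linarith
    then have "ereal (Re (F n x)) \<le> ereal (Re (of_real (M + 4 / 2 ^ n)))"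
      by (intro subharmonic_le_Re_entire[OF \<rho> uscF shF[OF open_ball] holomorphic_on_const _ x]) simp
    then show ?thesis by simp
  qed
  define h where "h = (\<lambda>x. INF n. ereal (Re (F n x)))"
  have h_le: "h x \<le> ereal (Re (F n x))" for x n
    unfolding h_def by (rule INF_lower) simp
  have usc_h: "usc_on A h" for A
    unfolding usc_on_def
  proof (intro ballI allI impI)
    fix x c assume x: "x \<in> A" "h x < c"
    then obtain n where "ereal (Re (F n x)) < c" unfolding h_def by (auto simp: INF_less_iff)
    then have "\<forall>\<^sub>F y in at x within A. ereal (Re (F n y)) < c"
      using uscF x(1) unfolding usc_on_def by blast
    then show "\<forall>\<^sub>F y in at x within A. h y < c"
      by eventually_elim (use h_le le_less_trans in blast)
  qed
  have h_M: "h x \<le> ereal M" if "x \<in> cball z \<rho>" for x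
  proof (rule ereal_le_from_halves)
    fix n show "h x \<le> ereal (M + 4 / 2 ^ n)"
      using h_le[of x n] F_le[OF that, of n] by (meson ereal_less_eq(3) order_trans)
  qed
  show ?thesis
  proof
    show "usc_on (cball z \<rho>) h" by (rule usc_h)
    show "h x \<le> ereal M" if "x \<in> cball z \<rho>" for x using h_M that .
    show "subharmonic_on (ball z \<rho>) h"
      unfolding subharmonic_on_def
    proof (intro conjI ballI)
      fix w assume w: "w \<in> ball z \<rho>"
      then show "h w < \<infinity>" using h_M[of w] by (cases "h w") auto
      obtain e where e: "e > 0" "cball w e \<subseteq> ball z \<rho>" using w open_ball open_contains_cball by metis
      have "h w \<le> circle_mean h w r" if r: "0 < r" "r < e" for r
      proof -
        have "sphere w r \<subseteq> cball w e" using r by auto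
        then have sub: "sphere w r \<subseteq> cball z \<rho>" using e(2) ball_subset_cball by blast
        have "circle_mean h w r = (INF n. circle_mean (\<lambda>x. ereal (Re (F n x))) w r)"
          unfolding h_def
        proof (rule circle_mean_INF_decseq[where M="\<bar>M\<bar> + 4"])
          show "(\<lambda>t. ereal (Re (F n (circ w r t)))) \<in> borel_measurable borel" for n
            by (rule usc_on_circ_measurable[OF uscF[of UNIV]]) simp
          fix x n assume "x \<in> sphere w r"
          then have x: "x \<in> cball z \<rho>" using sub by blast
          have "4 / 2 ^ n \<le> (4::real)" by (simp add: divide_simps)
          then show "ereal (Re (F n x)) \<le> ereal (\<bar>M\<bar> + 4)" using F_le[OF x, of n] by simp
          show "ereal (Re (F (Suc n) x)) \<le> ereal (Re (F n x))" using decF[OF x] by simp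
        qed (use r in auto)
        also have "\<dots> = (INF n. ereal (Re (F n w)))"
          using r by (intro INF_cong refl circle_mean_Re_holomorphic[of _ _ e] holomorphic_on_subset[OF F(1)]) auto
        finally show ?thesis by (simp add: h_def)
      qed
      then show "\<exists>e>0. cball w e \<subseteq> ball z \<rho> \<and> (\<forall>r. 0 < r \<and> r < e \<longrightarrow> h w \<le> circle_mean h w r)"
        using e by blast
    qed (rule usc_h)
    show "h x = f x" if x: "x \<in> sphere z \<rho>" for x
    proof (rule antisym)
      show "f x \<le> h x" unfolding h_def
      proof (rule INF_greatest)
        fix n
        have "G n x \<le> Re (F n x)" using F_lo[OF x, of n] by (smt (verit) divide_nonneg_pos zero_less_power)
        then show "f x \<le> ereal (Re (F n x))" using G(3)[OF x, of n] by (meson ereal_less_eq(3) order_trans)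
      qed
      \<comment> \<open>With n fixed, later functions F m lie below G n + 4/2^m, and this error
        vanishes.\<close>
      have "h x \<le> ereal (G n x)" for n
      proof (rule ereal_le_from_halves)
        fix m assume m: "n \<le> m"
        have "G m x \<le> G n x" by (rule lift_Suc_antimono_le[of "\<lambda>n. G n x", OF G(2)[OF x] m])
        then have "Re (F m x) \<le> G n x + 4 / 2 ^ m" using F_hi[OF x, of m] by simp
        then show "h x \<le> ereal (G n x + 4 / 2 ^ m)" using h_le[of x m] by (meson ereal_less_eq(3) order_trans)
      qed
      then have "h x \<le> (INF n. ereal (G n x))" by (intro INF_greatest)
      then show "h x \<le> f x" using G(5)[OF x] by simp
    qed
    show "circle_mean f z \<rho> \<le> h z"
      unfolding h_def
    proof (rule INF_greatest)
      fix n
      have "f x \<le> ereal (Re (F n x))" if x: "x \<in> sphere z \<rho>" for x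
      proof -
        have "G n x \<le> Re (F n x)" using F_lo[OF x, of n] by (smt (verit) divide_nonneg_pos zero_less_power)
        then show ?thesis using G(3)[OF x, of n] by (meson ereal_less_eq(3) order_trans)
      qed
      then have "circle_mean f z \<rho> \<le> circle_mean (\<lambda>x. ereal (Re (F n x))) z \<rho>"
        using \<rho> by (intro circle_mean_mono) auto
      also have "\<dots> = ereal (Re (F n z))"
        using \<rho> by (intro circle_mean_Re_holomorphic[of _ _ "\<rho> + 1"] holomorphic_on_subset[OF F(1)]) auto
      finally show "circle_mean f z \<rho> \<le> ereal (Re (F n z))" .
    qed
    show "u x \<le> h x" if u: "usc_on (cball z \<rho>) u" "subharmonic_on (ball z \<rho>) u"
      "\<forall>y\<in>sphere z \<rho>. u y \<le> f y" and x: "x \<in> cball z \<rho>" for u x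
      unfolding h_def
    proof (intro INF_greatest subharmonic_le_Re_entire[OF \<rho> u(1,2) F(1) _ x])
      fix n y assume y: "y \<in> sphere z \<rho>"
      have "G n y \<le> Re (F n y)" using F_lo[OF y, of n] by (smt (verit) divide_nonneg_pos zero_less_power)
      then show "u y \<le> ereal (Re (F n y))" using G(3)[OF y, of n] bspec[OF u(3) y] by (meson ereal_less_eq(3) order_trans)
    qed
    show "3 * h x - ereal (2 * M) \<le> h w" if R: "R > 0" "ball x R \<subseteq> ball z \<rho>" "w \<in> cball x (R/2)" for x w R
    proof -
      have "w \<in> ball x R" "x \<in> ball x R" using R by auto
      then have wx: "w \<in> cball z \<rho>" "x \<in> cball z \<rho>" using R(2) ball_subset_cball by blast+
      have har: "3 * Re (F n x) \<le> Re (F n w) + 2 * M + 8 / 2 ^ n" for n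
      proof -
        \<comment> \<open>The upper bound makes M + 4/2^n - Re (F n) nonnegative, so Harnack's
          inequality bounds F n from below at \<open>w\<close>. This is where 3h(x) - 2M comes
          from.\<close>
        have "Re (of_real (M + 4 / 2 ^ n) - F n w) \<le> 3 * Re (of_real (M + 4 / 2 ^ n) - F n x)"
        proof (rule Harnack_half_ball[where F="\<lambda>y. of_real (M + 4 / 2 ^ n) - F n y" and R=R])
          show "(\<lambda>x. of_real (M + 4 / 2 ^ n) - F n x) holomorphic_on ball x R"
            using holomorphic_on_subset[OF F(1)] by (intro holomorphic_intros) auto
          fix y assume "y \<in> ball x R"
          then have "y \<in> cball z \<rho>" using R(2) ball_subset_cball by blast
          then show "0 \<le> Re (of_real (M + 4 / 2 ^ n) - F n y)" using F_le[of y n] by simp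
        qed (use R in auto)
        then show ?thesis by simp
      qed
      have "3 * h x \<le> ereal (Re (F n w) + 2 * M)" for n
      proof (rule ereal_le_from_halves)
        fix m assume m: "m \<ge> n"
        have "3 * h x \<le> 3 * ereal (Re (F m x))" using h_le by (intro ereal_mult_left_mono) auto
        also have "\<dots> \<le> ereal (Re (F m w) + 2 * M + 8 / 2 ^ m)" using har[of m] by simp
        also have "\<dots> \<le> ereal (Re (F n w) + 2 * M + 8 / 2 ^ m)" using decF'[OF wx(1) m] by simp
        finally show "3 * h x \<le> ereal (Re (F n w) + 2 * M + 8 / 2 ^ m)" .
      qed
      then have "3 * h x - ereal (2 * M) \<le> ereal (Re (F n w))" for n
        by (subst ereal_minus_le_iff) (simp add: add.commute)
      then show ?thesis unfolding h_def by (intro INF_greatest) (simp add: h_def)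
    qed
  qed
qed

subsection \<open>Potentials of polar sets\<close>

text \<open>On the disc about \<open>w0\<close> reaching to \<open>a\<close>, the quotient (w - a) /
  (w0 - a) has positive real part, so the principal logarithm is holomorphic there.\<close>

lemma log_dist_locally_Re_holomorphic:
  assumes "w0 \<noteq> a"
  shows "\<exists>R>0. \<exists>F. F holomorphic_on ball w0 R \<and> (\<forall>w\<in>ball w0 R. ln (dist a w) = Re (F w))"
proof -
  define R where "R = dist a w0"
  have R: "R > 0" using assms by (auto simp: R_def)
  have re: "Re ((w - a) / (w0 - a)) > 0" if "w \<in> ball w0 R" for w
  proof -
    have e: "(w - a) / (w0 - a) = 1 + (w - w0) / (w0 - a)" using assms by (simp add: field_simps)
    have "norm ((w - w0) / (w0 - a)) < 1"
      using that R by (simp add: norm_divide R_def dist_norm norm_minus_commute)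
    then have "\<bar>Re ((w - w0) / (w0 - a))\<bar> < 1" using abs_Re_le_cmod le_less_trans by blast
    then show ?thesis unfolding e by simp
  qed
  define F where "F = (\<lambda>w. Ln ((w - a) / (w0 - a)) + of_real (ln (norm (w0 - a))))"
  have "F holomorphic_on ball w0 R"
    unfolding F_def
  proof (intro holomorphic_intros)
    fix w assume "w \<in> ball w0 R"
    from re[OF this] show "(w - a) / (w0 - a) \<notin> \<real>\<^sub>\<le>\<^sub>0"
      by (auto simp: complex_nonpos_Reals_iff)
  qed (use assms in auto)
  moreover have "ln (dist a w) = Re (F w)" if "w \<in> ball w0 R" for w
  proof -
    have "(w - a) / (w0 - a) \<noteq> 0" using re[OF that] by auto
    then have "Re (F w) = ln (norm (w - a) / norm (w0 - a)) + ln (norm (w0 - a))"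
      by (simp add: F_def norm_divide)
    also have "\<dots> = ln (norm (w - a))"
      using \<open>(w - a) / (w0 - a) \<noteq> 0\<close> by (subst ln_div) auto
    finally show ?thesis by (simp add: dist_norm norm_minus_commute)
  qed
  ultimately show ?thesis using R by blast
qed

text \<open>On an annulus around the ball, \<open>u\<close> lies below \<open>M + n (ln |z - a| - ln R)\<close> for every \<open>n\<close>.\<close>

lemma subharmonic_minus_infinity_spreads:
  assumes u: "subharmonic_on UNIV u" and s: "s > 0" and inf: "\<And>x. x \<in> ball a s \<Longrightarrow> u x = -\<infinity>"
  shows "u x = -\<infinity>"
proof (cases "x \<in> ball a s")
  case False
  define R where "R = dist a x + 1"
  have usc: "usc_on A u" for A using u usc_on_subset[of UNIV u A] by (auto simp: subharmonic_on_def)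
  obtain M where M: "\<And>y. y \<in> cball a R \<Longrightarrow> u y \<le> ereal M"
    by (rule usc_on_compact_bounded_above[OF compact_cball usc, of a R])
      (use u in \<open>auto simp: subharmonic_on_def\<close>)
  \<comment> \<open>The inner circle, of radius s/2, lies strictly inside the disc where
    \<open>u\<close> is -\<infinity>, so any bound holds on it. The outer radius exceeds |x - a|, so
    the logarithmic term is negative at \<open>x\<close>.\<close>
  define \<Omega> where "\<Omega> = ball a R - cball a (s/2)"
  have \<Omega>: "open \<Omega>" "bounded \<Omega>" unfolding \<Omega>_def by (auto intro: bounded_subset[OF bounded_ball])
  have x: "x \<in> \<Omega>" using False s by (auto simp: \<Omega>_def R_def)
  have cl: "closure \<Omega> \<subseteq> cball a R - ball a (s/2)"
    by (rule closure_minimal) (auto simp: \<Omega>_def intro: closed_Diff)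
  have dpos: "dist a y > 0" if "y \<in> closure \<Omega>" for y
    using cl that s by force
  have le: "u x \<le> ereal (M + real n * (ln (dist a x) - ln R))" for n
  proof (rule subharmonic_maximum_principle[where \<Omega>=\<Omega> and g="\<lambda>y. M + real n * (ln (dist a y) - ln R)"])
    show "continuous_on (closure \<Omega>) (\<lambda>y. M + real n * (ln (dist a y) - ln R))"
      by (intro continuous_intros) (use dpos in force)
    show "\<exists>\<delta>>0. \<exists>F. F holomorphic_on ball w0 \<delta> \<and> (\<forall>w\<in>ball w0 \<delta>. M + real n * (ln (dist a w) - ln R) = Re (F w))"
      if w0: "w0 \<in> \<Omega>" for w0
    proof -
      have "w0 \<noteq> a" using w0 s by (auto simp: \<Omega>_def)
      then obtain \<delta> F where F: "\<delta> > 0" "F holomorphic_on ball w0 \<delta>" "\<forall>w\<in>ball w0 \<delta>. ln (dist a w) = Re (F w)"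
        using log_dist_locally_Re_holomorphic by metis
      have "(\<lambda>w. of_real M + of_real (real n) * (F w - of_real (ln R))) holomorphic_on ball w0 \<delta>"
        by (intro holomorphic_intros F)
      then show ?thesis using F(1,3)
        by (intro exI[of _ \<delta>] conjI exI[of _ "\<lambda>w. of_real M + of_real (real n) * (F w - of_real (ln R))"]) auto
    qed
    fix y assume "y \<in> frontier \<Omega>"
    then have y: "y \<in> closure \<Omega>" "y \<notin> \<Omega>" using \<Omega>(1) by (auto simp: frontier_def interior_open)
    then have "dist a y = R \<or> dist a y = s/2" using cl by (auto simp: \<Omega>_def)
    then show "u y \<le> ereal (M + real n * (ln (dist a y) - ln R))"
    proof
      assume "dist a y = R" then show ?thesis using M[of y] by simp
    next
      assume "dist a y = s/2" then show ?thesis using inf[of y] s by simp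
    qed
  qed (use \<Omega> x usc u closure_subset subharmonic_on_subset in auto)
  have neg: "ln (dist a x) - ln R < 0" 
  proof -
    have pos: "dist a x > 0" using dpos[of x] x closure_subset by blast
    have less: "dist a x < R" by (simp add: R_def)
    then show ?thesis using iffD2[OF ln_less_cancel_iff[OF pos] less] pos by linarith
  qed
  show ?thesis
  proof (cases "u x")
    case (real b)
    obtain n where "real n * (ln R - ln (dist a x)) > M - b"
      using reals_Archimedean3[of "ln R - ln (dist a x)"] neg by auto
    moreover have "b \<le> M + real n * (ln (dist a x) - ln R)" using le[of n] real by simp
    ultimately show ?thesis by (simp add: algebra_simps)
  qed (use u in \<open>auto simp: subharmonic_on_def\<close>)
qed (use inf in auto)

text \<open>Finiteness at the centre is the point. Some \<open>x0\<close> within \<rho>/4 of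
  \<open>z\<close> has u x0 > -\<infinity>, and \<open>h\<close> dominates \<open>u\<close>.
  Harnack's inequality on the disc of radius \<rho>/2 about \<open>x0\<close>, which stays inside
  the given disc and has \<open>z\<close> in its half-size disc, passes this to
  \<open>z\<close>.\<close>

lemma Poisson_extension_subharmonic:
  assumes u: "subharmonic_on UNIV u" and ne: "u y \<noteq> -\<infinity>" and \<rho>: "\<rho> > 0"
    and M: "\<And>x. x \<in> sphere z \<rho> \<Longrightarrow> u x \<le> ereal M"
  obtains h where "usc_on (cball z \<rho>) h" "subharmonic_on (ball z \<rho>) h"
    "\<And>x. x \<in> sphere z \<rho> \<Longrightarrow> h x = u x" "\<And>x. x \<in> cball z \<rho> \<Longrightarrow> h x \<le> ereal M" "h z \<noteq> -\<infinity>"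
proof -
  have usc: "usc_on A u" for A using u usc_on_subset[of UNIV u A] by (auto simp: subharmonic_on_def)
  have sub: "subharmonic_on (ball z \<rho>) u" using u subharmonic_on_subset by blast
  obtain h where h: "usc_on (cball z \<rho>) h" "subharmonic_on (ball z \<rho>) h"
    "\<And>x. x \<in> sphere z \<rho> \<Longrightarrow> h x = u x" "\<And>x. x \<in> cball z \<rho> \<Longrightarrow> h x \<le> ereal M"
    and hu: "\<And>v x. usc_on (cball z \<rho>) v \<Longrightarrow> subharmonic_on (ball z \<rho>) v \<Longrightarrow>
      (\<forall>y\<in>sphere z \<rho>. v y \<le> u y) \<Longrightarrow> x \<in> cball z \<rho> \<Longrightarrow> v x \<le> h x"
    and har: "\<And>x w R. R > 0 \<Longrightarrow> ball x R \<subseteq> ball z \<rho> \<Longrightarrow> w \<in> cball x (R/2) \<Longrightarrow> 3 * h x - ereal (2 * M) \<le> h w"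
  proof (rule Poisson_extension_usc[OF \<rho> usc])
    show "u x \<le> ereal M" if "x \<in> sphere z \<rho>" for x using M that .
  qed (rule that)
  obtain x0 where x0: "x0 \<in> ball z (\<rho>/4)" "u x0 \<noteq> -\<infinity>"
    using subharmonic_minus_infinity_spreads[OF u, of "\<rho>/4" z y] ne \<rho> by auto
  have "u x0 \<le> h x0" using x0 \<rho> by (intro hu usc sub) auto
  then have "h x0 \<noteq> -\<infinity>" using x0 by auto
  moreover have "3 * h x0 - ereal (2 * M) \<le> h z"
  proof (rule har[of "\<rho>/2"])
    show "ball x0 (\<rho>/2) \<subseteq> ball z \<rho>"
    proof
      fix y assume "y \<in> ball x0 (\<rho>/2)"
      then show "y \<in> ball z \<rho>" using x0 \<rho> dist_triangle[of z y x0] by simp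
    qed
  qed (use x0 \<rho> in \<open>auto simp: dist_commute\<close>)
  ultimately have "h z \<noteq> -\<infinity>" by (cases "h x0") auto
  then show ?thesis using that h by blast
qed

lemma subharmonic_on_normalize:
  assumes u: "subharmonic_on UNIV u" and A: "bounded A"
  obtains M where "subharmonic_on UNIV (\<lambda>x. u x + ereal M)" "\<And>x. x \<in> A \<Longrightarrow> u x + ereal M \<le> 0"
proof -
  have "usc_on (closure A) u" "\<And>x. u x < \<infinity>"
    using u usc_on_subset[of UNIV u "closure A"] by (auto simp: subharmonic_on_def)
  moreover have "compact (closure A)" using A by (simp add: compact_closure)
  ultimately obtain M where M: "\<And>x. x \<in> closure A \<Longrightarrow> u x \<le> ereal M"
    using usc_on_compact_bounded_above by metis
  show ?thesis
  proof (rule that[of "- M"])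
    show "subharmonic_on UNIV (\<lambda>x. u x + ereal (- M))"
      by (intro subharmonic_on_add subharmonic_on_const u) auto
    fix x assume "x \<in> A"
    then have "u x \<le> ereal M" using M closure_subset by blast
    then show "u x + ereal (- M) \<le> 0" by (cases "u x") auto
  qed
qed

lemma polar_potential:
  assumes "polar K" "bounded A"
  obtains u y where "subharmonic_on UNIV u" "u y \<noteq> -\<infinity>" "\<And>x. x \<in> K \<Longrightarrow> u x = -\<infinity>" "\<And>x. x \<in> A \<Longrightarrow> u x \<le> 0"
proof -
  obtain u y where u: "subharmonic_on UNIV u" "u y \<noteq> -\<infinity>" "\<forall>x\<in>K. u x = -\<infinity>"
    using assms(1) unfolding polar_def by blast
  obtain M where "subharmonic_on UNIV (\<lambda>x. u x + ereal M)" "\<And>x. x \<in> A \<Longrightarrow> u x + ereal M \<le> 0"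
    by (rule subharmonic_on_normalize[OF u(1) assms(2)]) (rule that)
  then show ?thesis using u by (intro that[of "\<lambda>x. u x + ereal M" y]) auto
qed

text \<open>The disc around \<open>z\<close> misses \<open>K\<close>, so gluing in the Poisson
  integral leaves the poles on \<open>K\<close> untouched. Normalising \<open>u\<close> on the disc
  too keeps the new values nonpositive.\<close>

lemma polar_potential_finite_at:
  assumes K: "compact K" "polar K" and A: "bounded A" and z: "z \<notin> K"
  obtains u where "subharmonic_on UNIV u" "\<And>x. x \<in> K \<Longrightarrow> u x = -\<infinity>" "\<And>x. x \<in> A \<Longrightarrow> u x \<le> 0" "u z \<noteq> -\<infinity>"
proof -
  obtain \<rho> where \<rho>: "\<rho> > 0" "cball z \<rho> \<subseteq> - K"
    using open_contains_cball_eq[of "- K"] compact_imp_closed[OF K(1)] z by (auto simp: open_Compl)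
  obtain u y where u: "subharmonic_on UNIV u" "u y \<noteq> -\<infinity>" "\<And>x. x \<in> K \<Longrightarrow> u x = -\<infinity>"
    "\<And>x. x \<in> A \<union> cball z \<rho> \<Longrightarrow> u x \<le> 0"
    using polar_potential[OF K(2), of "A \<union> cball z \<rho>"] A by auto
  obtain h where h: "usc_on (cball z \<rho>) h" "subharmonic_on (ball z \<rho>) h"
    "\<And>x. x \<in> sphere z \<rho> \<Longrightarrow> h x = u x" "\<And>x. x \<in> cball z \<rho> \<Longrightarrow> h x \<le> ereal 0" "h z \<noteq> -\<infinity>"
  proof (rule Poisson_extension_subharmonic[OF u(1,2) \<rho>(1)])
    show "u x \<le> ereal 0" if "x \<in> sphere z \<rho>" for x using u(4)[of x] that by (simp add: zero_ereal_def)
  qed (rule that)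
  show ?thesis
  proof (rule that)
    show "subharmonic_on UNIV (\<lambda>x. if x \<in> cball z \<rho> then max (u x) (h x) else u x)"
      by (rule subharmonic_on_glue) (use u h in auto)
  qed (use u h \<rho> in \<open>auto simp: max_def zero_ereal_def\<close>)
qed

subsection \<open>Bouligand's lemma\<close>

text \<open>With upper bound 0, the deficit is the total length of the parameter set mapped into
  \<open>Q k\<close>, which tends to 0 by continuity of measure from above.\<close>

lemma circle_mean_neg_indicator_shrinking:
  fixes Q :: "nat \<Rightarrow> complex set"
  assumes op: "\<And>k. open (Q k)" and dec: "decseq Q" and emp: "(\<Inter>k. Q k) = {}" and r: "r > 0" and e: "e > 0"
  obtains k where "ereal (- e) \<le> circle_mean (\<lambda>x. if x \<in> Q k then -1 else 0) z r"
proof -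
  define A where "A = (\<lambda>k. {0..2*pi} \<inter> circ z r -` Q k)"
  have op': "open (circ z r -` Q k)" for k
    using op continuous_on_circ[of UNIV z r] by (intro open_vimage) auto
  then have A: "A k \<in> sets lborel" for k
    unfolding A_def by (auto intro!: sets.Int borel_closed)
  have "emeasure lborel (A k) \<le> emeasure lborel {0..2*pi}" for k
    by (intro emeasure_mono) (auto simp: A_def)
  then have fin: "emeasure lborel (A k) \<noteq> \<infinity>" for k
    using le_less_trans[of "emeasure lborel (A k)" "emeasure lborel {0..2*pi}" top] by simp
  have "(\<lambda>k. emeasure lborel (A k)) \<longlonglongrightarrow> emeasure lborel (\<Inter>k. A k)"
  proof (rule Lim_emeasure_decseq)
    show "range A \<subseteq> sets lborel" using A by blast
    show "decseq A" using dec unfolding decseq_def A_def by blast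
  qed (rule fin)
  moreover have "(\<Inter>k. A k) = {}" using emp unfolding A_def by blast
  ultimately have "(\<lambda>k. emeasure lborel (A k)) \<longlonglongrightarrow> 0" by simp
  moreover have "0 < ennreal (2 * pi * e)" using e by simp
  ultimately have "\<forall>\<^sub>F k in sequentially. emeasure lborel (A k) < ennreal (2 * pi * e)"
    by (rule order_tendstoD(2))
  then obtain k where k: "emeasure lborel (A k) < ennreal (2 * pi * e)"
    by (auto simp: eventually_sequentially)
  let ?f = "\<lambda>x. if x \<in> Q k then -1 else 0 :: ereal"
  have "e2ennreal (ereal 0 - ?f (circ z r t)) * indicator {0..2*pi} t = indicator (A k) t" for t
    by (auto simp: A_def indicator_def one_ereal_def e2ennreal_neg simp flip: zero_ereal_def)
  then have d: "circle_deficit 0 ?f z r = emeasure lborel (A k)"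
    unfolding circle_deficit_def using A by simp
  have [measurable]: "circ z r -` Q k \<in> sets borel" using op' by (rule borel_open)
  have "(\<lambda>t. ?f (circ z r t)) = (\<lambda>t. if t \<in> circ z r -` Q k then -1 else 0)" by auto
  also have "\<dots> \<in> borel_measurable borel" by measurable
  finally have meas: "(\<lambda>t. ?f (circ z r t)) \<in> borel_measurable borel" .
  have eq: "circle_mean ?f z r = ereal 0 - ereal (1 / (2*pi)) * enn2ereal (emeasure lborel (A k))"
    unfolding d[symmetric] by (rule circle_mean_eq_deficit[OF meas]) (use r in \<open>auto simp: zero_ereal_def[symmetric]\<close>)
  obtain m where m: "emeasure lborel (A k) = ennreal m" "m \<ge> 0" using fin[of k] by (cases "emeasure lborel (A k)") auto
  then have "m < 2 * pi * e" using k by (simp add: ennreal_less_iff)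
  then have "m / (2 * pi) \<le> e" by (simp add: field_simps)
  then have "ereal (- e) \<le> circle_mean ?f z r" unfolding eq m(1) using m(2) by simp
  then show ?thesis by (rule that)
qed

text \<open>Bouligand's lemma: the barrier only controls a compact part of the circle around \<open>z\<close>; the
  remaining relatively open part has small length and is absorbed by its harmonic measure \<open>- h\<close>.\<close>

lemma Bouligand:
  assumes D: "open D" and z: "z \<in> frontier D" and N: "open N" "z \<in> N"
    and b: "subharmonic_on (D \<inter> N) b" "\<And>x. x \<in> D \<inter> N \<Longrightarrow> b x < 0" "(b \<longlongrightarrow> 0) (at z within D \<inter> N)"
    and E: "closed E" "E \<subseteq> D" and \<eta>: "\<eta> > 0"
  obtains v \<delta> where "subharmonic_on D v" "\<And>x. x \<in> E \<Longrightarrow> v x \<le> -1" "\<And>x. x \<in> D \<Longrightarrow> v x \<le> 0"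
    "\<delta> > 0" "\<And>x. x \<in> D \<inter> ball z \<delta> \<Longrightarrow> ereal (- \<eta>) \<le> v x"
proof -
  have zD: "z \<notin> D" using D z by (auto simp: frontier_def interior_open)
  then have "z \<in> N \<inter> - E" using E N by auto
  moreover have "open (N \<inter> - E)" using N E by auto
  ultimately obtain \<rho> where \<rho>: "\<rho> > 0" "cball z \<rho> \<subseteq> N \<inter> - E" using open_contains_cball_eq by blast
  \<comment> \<open>The boundary layers of \<open>D\<close>: open, decreasing, and with empty
    intersection because \<open>D\<close> is open. What the circle retains of \<open>D\<close>
    outside a layer is compact.\<close>
  define Q where "Q = (\<lambda>k::nat. D \<inter> {x. infdist x (- D) < 1 / real (Suc k)})"
  have cD: "closed (- D)" "- D \<noteq> {}" using D zD by auto
  have opQ: "open (Q k)" for k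
    unfolding Q_def by (intro open_Int D open_Collect_less continuous_intros)
  have dec: "decseq Q"
    unfolding decseq_Suc_iff Q_def
  proof (intro allI subsetI)
    fix k x assume "x \<in> D \<inter> {x. infdist x (- D) < 1 / real (Suc (Suc k))}"
    moreover have "1 / real (Suc (Suc k)) \<le> 1 / real (Suc k)" by (simp add: divide_simps)
    ultimately show "x \<in> D \<inter> {x. infdist x (- D) < 1 / real (Suc k)}" by auto
  qed
  have emp: "(\<Inter>k. Q k) = {}"
  proof (rule ccontr)
    assume "(\<Inter>k. Q k) \<noteq> {}"
    then obtain x where x: "\<And>k. x \<in> Q k" by blast
    then have "x \<in> D" by (auto simp: Q_def)
    then have "infdist x (- D) \<noteq> 0" using in_closed_iff_infdist_zero[OF cD] by blast
    then have "infdist x (- D) > 0" using infdist_nonneg[of x "- D"] by linarith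
    then obtain k where "1 / real (Suc k) < infdist x (- D)" using nat_approx_posE by metis
    then show False using x[of k] by (auto simp: Q_def)
  qed
  \<comment> \<open>Harnack's factor 3 turns \<eta>/6 at the centre into \<eta>/2 on the half-size
    disc; the other \<eta>/2 is left for the barrier.\<close>
  have "\<eta> / 6 > 0" using \<eta> by simp
  then obtain k where k: "ereal (- (\<eta> / 6)) \<le> circle_mean (\<lambda>x. if x \<in> Q k then -1 else 0) z \<rho>"
    by (rule circle_mean_neg_indicator_shrinking[OF opQ dec emp \<rho>(1)])
  \<comment> \<open>Minus the indicator of an open set is upper semicontinuous, hence admissible
    boundary data.\<close>
  define f where "f = (\<lambda>x. if x \<in> Q k then -1 else 0 :: ereal)"
  have "usc_on (sphere z \<rho>) f"
    unfolding usc_on_def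
  proof (intro ballI allI impI)
    fix x c assume c: "f x < c"
    show "\<forall>\<^sub>F y in at x within sphere z \<rho>. f y < c"
    proof (cases "x \<in> Q k")
      case True
      then have "\<forall>\<^sub>F y in at x within sphere z \<rho>. y \<in> Q k"
        using opQ eventually_at_topological by blast
      then show ?thesis by eventually_elim (use c True in \<open>auto simp: f_def\<close>)
    next
      case False
      then have "0 < c" using c by (simp add: f_def)
      then have "f y < c" for y by (auto simp: f_def intro: order_less_trans[of _ 0])
      then show ?thesis by simp
    qed
  qed
  then obtain h where h: "usc_on (cball z \<rho>) h" "subharmonic_on (ball z \<rho>) h"
    "\<And>x. x \<in> sphere z \<rho> \<Longrightarrow> h x = f x" "\<And>x. x \<in> cball z \<rho> \<Longrightarrow> h x \<le> ereal 0"
    "circle_mean f z \<rho> \<le> h z"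
    "\<And>x w R. R > 0 \<Longrightarrow> ball x R \<subseteq> ball z \<rho> \<Longrightarrow> w \<in> cball x (R/2) \<Longrightarrow> 3 * h x - ereal (2 * 0) \<le> h w"
  proof (rule Poisson_extension_usc[OF \<rho>(1)])
    show "f x \<le> ereal 0" for x by (simp add: f_def zero_ereal_def[symmetric])
  qed (rule that)
  have hz: "ereal (- (\<eta> / 6)) \<le> h z" using k h(5) by (simp add: f_def)
  have h_near: "ereal (- (\<eta> / 2)) \<le> h w" if w: "w \<in> cball z (\<rho>/2)" for w
  proof -
    have "3 * ereal (- (\<eta> / 6)) \<le> 3 * h z" using hz by (intro ereal_mult_left_mono) auto
    then have "ereal (- (\<eta> / 2)) \<le> 3 * h z - ereal (2 * 0)" by (simp add: zero_ereal_def[symmetric])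
    then show ?thesis using h(6)[OF \<rho>(1) _ w] by (meson order_refl order_trans)
  qed
  \<comment> \<open>On this compact part of the circle, inside \<open>D \<inter> N\<close>, the
    negative barrier attains a maximum and so stays below some -m.\<close>
  define C where "C = sphere z \<rho> \<inter> {x. 1 / real (Suc k) \<le> infdist x (- D)}"
  have "compact C" unfolding C_def
    by (intro compact_Int_closed closed_Collect_le continuous_intros) auto
  have CD: "C \<subseteq> D \<inter> N"
  proof
    fix x assume x: "x \<in> C"
    then have "infdist x (- D) > 0" by (auto simp: C_def intro: less_le_trans[rotated])
    then have "x \<in> D" using infdist_zero[of x "- D"] by (cases "x \<in> D") auto
    then show "x \<in> D \<inter> N" using x \<rho> by (auto simp: C_def)
  qed
  have "\<exists>m>0. \<forall>x\<in>C. b x \<le> ereal (- m)"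
  proof (cases "C = {}")
    case False
    have "usc_on C b" using b(1) CD usc_on_subset by (auto simp: subharmonic_on_def)
    then obtain a where a: "a \<in> C" "\<And>x. x \<in> C \<Longrightarrow> b x \<le> b a"
      using usc_on_attains_sup[OF \<open>compact C\<close> False] by blast
    have "b a < 0" using b(2) a CD by blast
    then obtain m where "m > 0" "b a \<le> ereal (- m)"
      by (cases "b a") (auto intro: that[of 1] that[of "- real_of_ereal (b a)"])
    then show ?thesis using a(2) order_trans by blast
  qed (auto intro: exI[of _ 1])
  then obtain m where m: "m > 0" "\<And>x. x \<in> C \<Longrightarrow> b x \<le> ereal (- m)" by blast
  \<comment> \<open>Both terms are nonpositive, and on every point of the circle in \<open>D\<close>
    one of them is at most -1: \<open>h\<close> in the layer \<open>Q k\<close>, the scaled barrier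
    on \<open>C\<close>. So \<open>s\<close> glues to the constant -1 outside the disc, where
    \<open>E\<close> lies.\<close>
  define s where "s = (\<lambda>x. ereal (1/m) * b x + h x)"
  define v where "v = (\<lambda>x. if x \<in> cball z \<rho> then max (ereal (-1)) (s x) else ereal (-1))"
  have DN: "D \<inter> cball z \<rho> \<subseteq> D \<inter> N" using \<rho> by blast
  have bm: "ereal (1/m) * b x \<le> 0" if "x \<in> D \<inter> cball z \<rho>" for x
    using b(2)[of x] DN that m by (cases "b x") (auto simp: divide_nonpos_pos mult_nonneg_nonpos)
  have h0: "h x \<le> 0" if "x \<in> cball z \<rho>" for x using h(4)[OF that] by (simp add: zero_ereal_def)
  have s0: "s x \<le> 0" if "x \<in> D \<inter> cball z \<rho>" for x
    unfolding s_def using bm[OF that] h0[of x] that add_nonpos_nonpos by blast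
  have s_usc: "usc_on (D \<inter> cball z \<rho>) s"
    unfolding s_def
  proof (rule usc_on_add)
    show "usc_on (D \<inter> cball z \<rho>) (\<lambda>x. ereal (1/m) * b x)"
      using b(1) DN m usc_on_subset by (intro usc_on_cmult) (auto simp: subharmonic_on_def)
    show "usc_on (D \<inter> cball z \<rho>) h" using h(1) usc_on_subset by blast
    fix x assume x: "x \<in> D \<inter> cball z \<rho>"
    show "ereal (1/m) * b x < \<infinity>" using bm[OF x] by (rule le_less_trans) simp
    show "h x < \<infinity>" using h0[of x] x by (auto intro: le_less_trans)
  qed
  have op: "open (D \<inter> ball z \<rho>)" "open (D \<inter> N)" using D N by auto
  have "subharmonic_on (D \<inter> ball z \<rho>) b"
    by (rule subharmonic_on_subset[OF b(1) op(2) op(1)]) (use DN in auto)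
  then have "subharmonic_on (D \<inter> ball z \<rho>) (\<lambda>x. ereal (1/m) * b x)"
    using m by (intro subharmonic_on_cmult) auto
  moreover have "subharmonic_on (D \<inter> ball z \<rho>) h"
    by (rule subharmonic_on_subset[OF h(2) open_ball op(1)]) auto
  ultimately have s_sh: "subharmonic_on (D \<inter> ball z \<rho>) s"
    unfolding s_def using op(1) by (intro subharmonic_on_add)
  have s_bd: "s x \<le> ereal (-1)" if x: "x \<in> D \<inter> sphere z \<rho>" for x
  proof (cases "x \<in> Q k")
    case True
    then have "h x = ereal (-1)" using h(3)[of x] x by (simp add: f_def one_ereal_def)
    then show ?thesis unfolding s_def using add_mono[OF bm[of x] order_refl[of "h x"]] x by simp
  next
    case False
    then have "x \<in> C" using x by (auto simp: Q_def C_def)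
    then have "ereal (1/m) * b x \<le> ereal (1/m) * ereal (- m)" using m by (intro ereal_mult_left_mono) auto
    then show ?thesis unfolding s_def using add_mono[OF _ h0[of x], of "ereal (1/m) * b x" "ereal (-1)"] x m by simp
  qed
  have v_sh: "subharmonic_on D v"
    unfolding v_def by (rule subharmonic_on_glue[OF D subharmonic_on_const[OF D] s_usc s_sh s_bd])
  \<comment> \<open>After division by \<open>m\<close>, the barrier contributes at least -\<eta>/2
    near \<open>z\<close>.\<close>
  have "ereal (- (m * \<eta> / 2)) < 0" using m \<eta> by simp
  then have "\<forall>\<^sub>F x in at z within D \<inter> N. ereal (- (m * \<eta> / 2)) < b x"
    using b(3) order_tendstoD(1) by blast
  then obtain d where d: "d > 0" "\<And>x. x \<in> D \<inter> N \<Longrightarrow> x \<noteq> z \<Longrightarrow> dist x z < d \<Longrightarrow> ereal (- (m * \<eta> / 2)) < b x"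
    unfolding eventually_at by blast
  show ?thesis
  proof (rule that[OF v_sh])
    show "v x \<le> -1" if "x \<in> E" for x
      using that \<rho> by (auto simp: v_def one_ereal_def)
    show "v x \<le> 0" if "x \<in> D" for x
      using that s0[of x] by (auto simp: v_def)
    show "min d (\<rho>/2) > 0" using d \<rho> by simp
    fix x assume x: "x \<in> D \<inter> ball z (min d (\<rho>/2))"
    then have xc: "x \<in> cball z \<rho>" "x \<in> cball z (\<rho>/2)" using \<rho> by auto
    have "x \<in> D \<inter> N" "x \<noteq> z" "dist x z < d" using x DN xc(1) zD by (auto simp: dist_commute)
    then have "ereal (- (m * \<eta> / 2)) < b x" by (rule d(2))
    then have "ereal (1/m) * ereal (- (m * \<eta> / 2)) \<le> ereal (1/m) * b x"
      using m by (intro ereal_mult_left_mono) auto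
    then have "ereal (- (\<eta> / 2)) \<le> ereal (1/m) * b x" using m by simp
    then have "ereal (- (\<eta> / 2)) + ereal (- (\<eta> / 2)) \<le> s x"
      unfolding s_def using h_near[OF xc(2)] by (rule add_mono)
    then have "ereal (- \<eta>) \<le> s x" by simp
    then show "ereal (- \<eta>) \<le> v x" using xc(1) by (simp add: v_def le_max_iff_disj)
  qed
qed

subsection \<open>Extension of competitors across polar sets\<close>

lemma ereal_le_uminus_swap: "a \<le> - b \<longleftrightarrow> b \<le> - a" for a b :: ereal
  by (cases a; cases b) auto

lemma rel_extremal_le:
  assumes "subharmonic_on \<Omega> v" "\<And>x. x \<in> E \<Longrightarrow> v x \<le> -1" "\<And>x. x \<in> \<Omega> \<Longrightarrow> v x \<le> 0"
  shows "rel_extremal z E \<Omega> \<le> - v z"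
  unfolding rel_extremal_def ereal_minus_le_minus using assms by (intro SUP_upper) auto

lemma rel_extremal_mono_domain:
  assumes "open \<Omega>" "open \<Omega>'" "\<Omega> \<subseteq> \<Omega>'"
  shows "rel_extremal z E \<Omega> \<le> rel_extremal z E \<Omega>'"
  unfolding rel_extremal_def ereal_minus_le_minus
proof (rule SUP_subset_mono)
  show "{v. subharmonic_on \<Omega>' v \<and> (\<forall>x\<in>E. v x \<le> -1) \<and> (\<forall>x\<in>\<Omega>'. v x \<le> 0)}
      \<subseteq> {v. subharmonic_on \<Omega> v \<and> (\<forall>x\<in>E. v x \<le> -1) \<and> (\<forall>x\<in>\<Omega>. v x \<le> 0)}"
    using subharmonic_on_subset[OF _ assms(2,1,3)] assms(3) by blast
qed simp

lemma rel_extremal_nonneg: "z \<in> \<Omega> \<Longrightarrow> 0 \<le> rel_extremal z E \<Omega>"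
  unfolding rel_extremal_def by (subst ereal_0_le_uminus_iff) (auto intro!: SUP_least)

text \<open>A competitor on \<open>D\<close>, lowered by \<open>\<epsilon>u\<close> and truncated at \<open>-1\<close>, is constant near the
  poles of \<open>u\<close>, hence extends across them.\<close>

lemma subharmonic_extension_across_poles:
  fixes \<epsilon> :: real
  assumes D: "open D" and v: "subharmonic_on D v" "\<forall>x\<in>D. v x \<le> 0"
    and u: "subharmonic_on UNIV u" and \<epsilon>: "\<epsilon> > 0"
  defines "U \<equiv> {x. ereal \<epsilon> * u x < -1}"
  shows "open U"
    and "subharmonic_on (D \<union> U) (\<lambda>x. if x \<in> D then max (v x + ereal \<epsilon> * u x) (ereal (-1)) else ereal (-1))"
      (is "subharmonic_on _ ?w")
proof -
  have eu: "subharmonic_on UNIV (\<lambda>x. ereal \<epsilon> * u x)"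
    using u \<epsilon> by (rule subharmonic_on_cmult)
  then have "openin (top_of_set UNIV) {x\<in>UNIV. ereal \<epsilon> * u x < -1}"
    unfolding subharmonic_on_def usc_on_openin by blast
  then show U: "open U" by (simp add: U_def)
  have "subharmonic_on D (\<lambda>x. ereal \<epsilon> * u x)"
    using eu D subharmonic_on_subset by blast
  then have "subharmonic_on D (\<lambda>x. max (v x + ereal \<epsilon> * u x) (ereal (-1)))"
    by (intro subharmonic_on_max subharmonic_on_add subharmonic_on_const D v)
  then have 1: "subharmonic_on D ?w"
    by (rule subharmonic_on_cong[OF D, rotated]) auto
  have "?w x = ereal (-1)" if "x \<in> U" for x
  proof (cases "x \<in> D")
    case True
    then have "v x + ereal \<epsilon> * u x \<le> 0 + ereal \<epsilon> * u x" using v(2) by (intro add_right_mono) blast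
    also have "\<dots> \<le> ereal (-1)" using that by (simp add: U_def one_ereal_def)
    finally show ?thesis by (auto simp: max_def)
  qed auto
  then have 2: "subharmonic_on U ?w"
    by (intro subharmonic_on_cong[OF U _ subharmonic_on_const[OF U]]) auto
  show "subharmonic_on (D \<union> U) ?w"
    using 1 2 D U by (rule subharmonic_on_Un)
qed

text \<open>The passage \<epsilon> \<rightarrow> 0 for competitors; \<open>c\<close> is the finite
  value at \<open>z\<close> of the potential or of its Poisson integral.\<close>

lemma ereal_le_from_scaled:
  assumes "\<And>\<epsilon>::real. \<epsilon> > 0 \<Longrightarrow> a + ereal (\<epsilon> * c) \<le> b"
  shows "a \<le> (b::ereal)"
proof (cases a)
  case (real r)
  have "ereal r \<le> b"
  proof (rule ereal_le_epsilon2)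
    fix e :: real assume e: "0 < e"
    \<comment> \<open>The 1 in the denominator also covers c = 0.\<close>
    have "e / (\<bar>c\<bar> + 1) * c \<ge> - e"
    proof -
      have "\<bar>e / (\<bar>c\<bar> + 1) * c\<bar> = e * (\<bar>c\<bar> / (\<bar>c\<bar> + 1))" using e by (simp add: abs_mult)
      also have "\<dots> \<le> e * 1" using e by (intro mult_left_mono) auto
      finally show ?thesis unfolding abs_le_iff by (simp only: mult_1_right minus_le_iff)
    qed
    moreover have "ereal r + ereal (e / (\<bar>c\<bar> + 1) * c) \<le> b"
      using assms[of "e / (\<bar>c\<bar> + 1)"] e real by (simp add: add_nonneg_pos)
    ultimately show "ereal r \<le> b + ereal e" by (cases b) auto
  qed
  then show ?thesis using real by simp
next
  case PInf
  then show ?thesis using assms[of 1] by simp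
qed simp

lemma rel_extremal_polar_extension:
  assumes D: "open D" "bounded D" and E: "E \<subseteq> D" and K: "compact K" "polar K" "K \<inter> D = {}" and z: "z \<in> D"
  shows "(INF U \<in> {U. open U \<and> K \<subseteq> U}. rel_extremal z E (D \<union> U)) = rel_extremal z E D"
    (is "?I = _")
proof (rule antisym)
  show "rel_extremal z E D \<le> ?I"
    using D(1) by (intro INF_greatest rel_extremal_mono_domain) auto
  have "z \<notin> K" using K(3) z by auto
  then obtain u where u: "subharmonic_on UNIV u" "\<And>x. x \<in> K \<Longrightarrow> u x = -\<infinity>" "\<And>x. x \<in> D \<Longrightarrow> u x \<le> 0" "u z \<noteq> -\<infinity>"
    by (rule polar_potential_finite_at[OF K(1,2) D(2)]) (rule that)
  have "u z \<noteq> \<infinity>" using u(3)[OF z] by auto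
  then obtain c where c: "u z = ereal c" using u(4) by (cases "u z") auto
  have "v z \<le> - ?I" if v: "subharmonic_on D v" "\<forall>x\<in>E. v x \<le> -1" "\<forall>x\<in>D. v x \<le> 0" for v
  proof (rule ereal_le_from_scaled)
    fix \<epsilon> :: real assume \<epsilon>: "\<epsilon> > 0"
    \<comment> \<open>Each \<epsilon> has its own neighbourhood of \<open>K\<close>; any one of them
      bounds the infimum from above.\<close>
    define U where "U = {x. ereal \<epsilon> * u x < -1}"
    define w where "w = (\<lambda>x. if x \<in> D then max (v x + ereal \<epsilon> * u x) (ereal (-1)) else ereal (-1))"
    have U: "open U" and w: "subharmonic_on (D \<union> U) w"
      unfolding U_def w_def by (rule subharmonic_extension_across_poles[OF D(1) v(1,3) u(1) \<epsilon>])+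
    have KU: "K \<subseteq> U" using u(2) \<epsilon> by (auto simp: U_def)
    have eu: "ereal \<epsilon> * u x \<le> 0" if "x \<in> D" for x
      using u(3)[OF that] \<epsilon> by (cases "u x") (auto simp: mult_nonneg_nonpos)
    have vu: "v x + ereal \<epsilon> * u x \<le> v x" if "x \<in> D" for x
      using add_left_mono[OF eu[OF that], of "v x"] by simp
    have "?I \<le> rel_extremal z E (D \<union> U)" using U KU by (intro INF_lower) auto
    also have "\<dots> \<le> - w z"
    proof (rule rel_extremal_le[OF w])
      fix x assume "x \<in> E"
      then have "x \<in> D" "v x \<le> -1" using E v by auto
      then show "w x \<le> -1" using order_trans[OF vu[of x], of "-1"] by (auto simp: w_def one_ereal_def)
    next
      fix x show "w x \<le> 0"
        using order_trans[OF vu[of x], of 0] v(3) by (auto simp: w_def)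
    qed
    finally have "w z \<le> - ?I" by (subst ereal_le_uminus_swap)
    moreover have "v z + ereal (\<epsilon> * c) \<le> w z" using z by (simp add: w_def c)
    ultimately show "v z + ereal (\<epsilon> * c) \<le> - ?I" by simp
  qed
  then have "(SUP v \<in> {v. subharmonic_on D v \<and> (\<forall>x\<in>E. v x \<le> -1) \<and> (\<forall>x\<in>D. v x \<le> 0)}. v z) \<le> - ?I"
    by (intro SUP_least) auto
  then show "?I \<le> rel_extremal z E D"
    unfolding rel_extremal_def[of z E D] by (subst ereal_le_uminus_swap)
qed

lemma rel_extremal_polar_extension_regular:
  assumes D: "open D" "bounded D" and E: "closed E" "E \<subseteq> D" and K: "polar K" and z: "z \<in> K"
    and reg: "regular_boundary_point D z"
  shows "(INF U \<in> {U. open U \<and> K \<subseteq> U}. rel_extremal z E (D \<union> U)) = 0"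
    (is "?I = 0")
proof (rule antisym)
  show "0 \<le> ?I" using z by (intro INF_greatest rel_extremal_nonneg) auto
  obtain N b where N: "open N" "z \<in> N" and fr: "z \<in> frontier D"
    and b: "subharmonic_on (D \<inter> N) b" "\<And>x. x \<in> D \<inter> N \<Longrightarrow> b x < 0" "(b \<longlongrightarrow> 0) (at z within D \<inter> N)"
    using reg unfolding regular_boundary_point_def by metis
  have zD: "z \<notin> D" using D(1) fr by (auto simp: frontier_def interior_open)
  have "?I \<le> 0 + ereal \<eta>" if \<eta>: "\<eta> > 0" for \<eta>
  proof -
    obtain v \<delta> where v: "subharmonic_on D v" "\<And>x. x \<in> E \<Longrightarrow> v x \<le> -1" "\<And>x. x \<in> D \<Longrightarrow> v x \<le> 0"
      and \<delta>: "\<delta> > 0" "\<And>x. x \<in> D \<inter> ball z \<delta> \<Longrightarrow> ereal (- \<eta>) \<le> v x"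
    proof (rule Bouligand[OF D(1) fr N b(1) _ b(3) E \<eta>])
      show "b x < 0" if "x \<in> D \<inter> N" for x using b(2) that .
    qed (rule that)
    have "z \<in> - E" "open (- E)" using E zD by auto
    then obtain \<rho>0 where \<rho>0: "\<rho>0 > 0" "cball z \<rho>0 \<subseteq> - E" using open_contains_cball_eq by blast
    \<comment> \<open>The disc avoids \<open>E\<close>, so raising the competitor on it does not
      spoil the bound on \<open>E\<close>; it lies within \<delta> of \<open>z\<close>, so
      \<open>v\<close> is at least -\<eta> on its part in \<open>D\<close>.\<close>
    define \<rho> where "\<rho> = min \<rho>0 (\<delta>/2)"
    have \<rho>: "\<rho> > 0" "cball z \<rho> \<subseteq> - E" "cball z \<rho> \<subseteq> ball z \<delta>" using \<rho>0 \<delta> by (auto simp: \<rho>_def)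
    \<comment> \<open>Nonpositivity is wanted on \<open>D\<close>, where \<epsilon>u lowers
      \<open>v\<close>, and on the circle, where it forces the Poisson integral below 0.\<close>
    have "bounded (D \<union> cball z \<rho>)" using D by auto
    then obtain u y where u: "subharmonic_on UNIV u" "u y \<noteq> -\<infinity>" "\<And>x. x \<in> K \<Longrightarrow> u x = -\<infinity>"
      "\<And>x. x \<in> D \<union> cball z \<rho> \<Longrightarrow> u x \<le> 0"
      by (rule polar_potential[OF K]) (rule that)
    obtain h where h: "usc_on (cball z \<rho>) h" "subharmonic_on (ball z \<rho>) h"
      "\<And>x. x \<in> sphere z \<rho> \<Longrightarrow> h x = u x" "\<And>x. x \<in> cball z \<rho> \<Longrightarrow> h x \<le> ereal 0" "h z \<noteq> -\<infinity>"
    proof (rule Poisson_extension_subharmonic[OF u(1,2) \<rho>(1)])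
      show "u x \<le> ereal 0" if "x \<in> sphere z \<rho>" for x using u(4)[of x] that by (simp add: zero_ereal_def)
    qed (rule that)
    have "h z \<noteq> \<infinity>" using h(4)[of z] \<rho> by auto
    then obtain c where c: "h z = ereal c" using h(5) by (cases "h z") auto
    have "ereal (- \<eta>) \<le> - ?I"
    proof (rule ereal_le_from_scaled)
      fix \<epsilon> :: real assume \<epsilon>: "\<epsilon> > 0"
      define U where "U = {x. ereal \<epsilon> * u x < -1}"
      define w where "w = (\<lambda>x. if x \<in> D then max (v x + ereal \<epsilon> * u x) (ereal (-1)) else ereal (-1))"
      have v3: "\<forall>x\<in>D. v x \<le> 0" using v(3) by blast
      have U: "open U" and w: "subharmonic_on (D \<union> U) w"
        unfolding U_def w_def by (rule subharmonic_extension_across_poles[OF D(1) v(1) v3 u(1) \<epsilon>])+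
      have KU: "K \<subseteq> U" using u(3) \<epsilon> by (auto simp: U_def)
      have eu: "ereal \<epsilon> * u x \<le> 0" if "x \<in> D" for x
        using u(4)[of x] that \<epsilon> by (cases "u x") (auto simp: mult_nonneg_nonpos)
      have vu: "v x + ereal \<epsilon> * u x \<le> v x" if "x \<in> D" for x
        using add_left_mono[OF eu[OF that], of "v x"] by simp
      have wE: "w x \<le> -1" if "x \<in> E" for x
        using order_trans[OF vu[of x] v(2)[OF that]] E that by (auto simp: w_def one_ereal_def)
      have w0: "w x \<le> 0" for x
        using order_trans[OF vu[of x] v(3)] by (auto simp: w_def)
      \<comment> \<open>Since \<open>z\<close> lies outside \<open>D\<close>, the extended
        competitor is only -1 there; the value of \<open>s\<close> at \<open>z\<close> is -\<eta> +
        \<epsilon>c, with \<open>c\<close> finite.\<close>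
      define s where "s = (\<lambda>x. ereal (- \<eta>) + ereal \<epsilon> * h x)"
      define w' where "w' = (\<lambda>x. if x \<in> cball z \<rho> then max (w x) (s x) else w x)"
      have h0: "ereal \<epsilon> * h x \<le> 0" if "x \<in> cball z \<rho>" for x
        using h(4)[OF that] \<epsilon> by (cases "h x") (auto simp: mult_nonneg_nonpos)
      have op: "open (D \<union> U)" "open ((D \<union> U) \<inter> ball z \<rho>)" using D U by auto
      have w': "subharmonic_on (D \<union> U) w'"
        unfolding w'_def
      proof (rule subharmonic_on_glue[OF op(1) w])
        have "usc_on (cball z \<rho>) s" unfolding s_def
        proof (intro usc_on_add usc_on_cmult[OF h(1) \<epsilon>] usc_on_continuous[OF continuous_on_const])
          fix x assume "x \<in> cball z \<rho>"
          from h0[OF this] show "ereal \<epsilon> * h x < \<infinity>" by (rule le_less_trans) simp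
        qed simp
        then show "usc_on ((D \<union> U) \<inter> cball z \<rho>) s" by (rule usc_on_subset) auto
        have "subharmonic_on (ball z \<rho>) s" unfolding s_def
          by (intro subharmonic_on_add subharmonic_on_cmult[OF h(2) \<epsilon>] subharmonic_on_const open_ball)
        then show "subharmonic_on ((D \<union> U) \<inter> ball z \<rho>) s"
          by (rule subharmonic_on_subset[OF _ open_ball op(2)]) auto
        fix x assume x: "x \<in> (D \<union> U) \<inter> sphere z \<rho>"
        then have sx: "s x = ereal (- \<eta>) + ereal \<epsilon> * u x" using h(3) by (simp add: s_def)
        show "s x \<le> w x"
        proof (cases "x \<in> D")
          case True
          then have "ereal (- \<eta>) \<le> v x" using \<delta>(2)[of x] \<rho>(3) x by auto
          then have "s x \<le> v x + ereal \<epsilon> * u x" unfolding sx by (rule add_right_mono)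
          then show ?thesis using True by (simp add: w_def le_max_iff_disj)
        next
          case False
          \<comment> \<open>A point of the circle outside \<open>D\<close> lies in \<open>U\<close>,
            where \<epsilon>u < -1; thus \<open>s\<close> stays below -1, the value of
            \<open>w\<close> there.\<close>
          then have "ereal \<epsilon> * u x \<le> ereal (-1)" using x by (auto simp: U_def one_ereal_def)
          then have "s x \<le> ereal (- \<eta>) + ereal (-1)" unfolding sx by (rule add_left_mono)
          also have "\<dots> \<le> ereal (-1)" using \<eta> by simp
          finally show ?thesis using False by (simp add: w_def)
        qed
      qed
      have "?I \<le> rel_extremal z E (D \<union> U)" using U KU by (intro INF_lower) auto
      also have "\<dots> \<le> - w' z"
      proof (rule rel_extremal_le[OF w'])
        show "w' x \<le> -1" if "x \<in> E" for x
          using that wE[OF that] \<rho>(2) by (auto simp: w'_def)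
        show "w' x \<le> 0" for x
        proof (cases "x \<in> cball z \<rho>")
          case True
          have "ereal (- \<eta>) \<le> 0" using \<eta> by simp
          from add_mono[OF this h0[OF True]] have "s x \<le> 0" by (simp add: s_def)
          then show ?thesis using w0[of x] by (simp only: w'_def True if_True max.bounded_iff)
        qed (use w0[of x] in \<open>simp add: w'_def\<close>)
      qed
      finally have "w' z \<le> - ?I" by (subst ereal_le_uminus_swap)
      moreover have "ereal (- \<eta>) + ereal (\<epsilon> * c) \<le> w' z" using \<rho> by (simp add: w'_def s_def c)
      ultimately show "ereal (- \<eta>) + ereal (\<epsilon> * c) \<le> - ?I" by (rule order_trans[rotated])
    qed
    then have "?I \<le> - ereal (- \<eta>)" by (subst ereal_le_uminus_swap)
    then show ?thesis by simp
  qed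
  then show "?I \<le> 0" by (rule ereal_le_epsilon2)
qed

theorem theorem3p7:
  fixes D K :: "complex set" and c :: complex and r :: real
  assumes "open D" and "connected D" and "bounded D"
    and "r > 0" and "cball c r \<subseteq> D"
    and "compact K" and "K \<subseteq> frontier D" and "polar K"
  shows "(\<forall>z\<in>D. rel_extremal z (cball c r) D =
            (INF U \<in> {U. open U \<and> K \<subseteq> U}. rel_extremal z (cball c r) (D \<union> U))) \<and>
         (\<forall>z\<in>K. regular_boundary_point D z \<longrightarrow>
            (INF U \<in> {U. open U \<and> K \<subseteq> U}. rel_extremal z (cball c r) (D \<union> U)) = 0)"
proof -
  have disj: "K \<inter> D = {}" using assms by (auto simp: frontier_def interior_open)
  show ?thesis
  proof (intro conjI ballI impI)
    fix z assume "z \<in> D"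
    then show "rel_extremal z (cball c r) D =
        (INF U \<in> {U. open U \<and> K \<subseteq> U}. rel_extremal z (cball c r) (D \<union> U))"
      by (rule rel_extremal_polar_extension[OF assms(1,3,5,6,8) disj, symmetric])
  next
    fix z assume "z \<in> K" "regular_boundary_point D z"
    then show "(INF U \<in> {U. open U \<and> K \<subseteq> U}. rel_extremal z (cball c r) (D \<union> U)) = 0"
      by (rule rel_extremal_polar_extension_regular[OF assms(1,3) closed_cball assms(5,8)])
  qed
qed

end
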